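(* Let $\mathbf{A}$ be a finite algebra in a Taylor variety and let $\mathbb{G}=(A,E)$ be a smooth digraph of algebraic length one, with vertex set the universe $A$ of $\mathbf{A}$, such that $E$ is a subuniverse of $\mathbf{A}^2$. Then $\mathbb{G}$ contains a loop, i.e. there is $a\in A$ with $(a,a)\in E$. Moreover, if there exists a nonempty absorbing subuniverse $I$ of $\mathbf{A}$ which is contained in a weak component of $\mathbb{G}$ of algebraic length $1$, then there is a minimal absorbing subuniverse $J$ of $\mathbf{A}$ and an element $a\in J$ with $(a,a)\in E$.
   Context: A term $t$ of arity $k$ is a Taylor term of a variety if it is idempotent ($t(x,\dots,x)\approx x$) and for every $j<k$ it satisfies an identity $t(\Box_0,\dots,\Box_{k-1})\approx t(\triangle_0,\dots,\triangle_{k-1})$, where all $\Box_i,\triangle_i$ are variables from $\{x,y\}$, $\Box_j$ is $x$ and $\triangle_j$ is $y$. A variety is idempotent if all its terms are idempotent; an idempotent variety is a Taylor variety if it has a Taylor term. A subuniverse $B$ of $\mathbf{A}$ is an absorbing subuniverse of $\mathbf{A}$ if there is a term operation $t$ of $\mathbf{A}$ such that for every coordinate $k$ of $t$ and all $a_0,\dots,a_{n-1}\in A$ ($n$ the arity of $t$) with $a_i\in B$ for all $i\neq k$, one has $t(a_0,\dots,a_{n-1})\in B$. A minimal absorbing subuniverse of $\mathbf{A}$ is a nonempty absorbing subuniverse $J$ of $\mathbf{A}$ such that no subuniverse $J'$ with $\emptyset\neq J'\subsetneq J$ is an absorbing subuniverse of $\mathbf{A}$. A digraph $(V,E)$ has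 a finite vertex set $V$ and edge set $E\subseteq V\times V$; it is smooth if every vertex has at least one incoming and at least one outgoing edge. An oriented path is a digraph with (distinct) vertices $p_0,\dots,p_k$ and exactly $k$ edges: for each $i<k$ either $(p_i,p_{i+1})$ (forward) or $(p_{i+1},p_i)$ (backward). Its algebraic length is the number of forward edges minus the number of backward edges. A vertex $a$ is connected to $b$ via an oriented path $\mathbb{P}$ if there is a digraph homomorphism from $\mathbb{P}$ with $p_0\mapsto a$, $p_k\mapsto b$. The weak components are the blocks of the equivalence "$a$ is connected to $b$ via some oriented path" (or the corresponding induced subdigraphs). A digraph has algebraic length $k$ if $k$ is the minimal positive integer such that some vertex $a$ is connected to itself via an oriented path of algebraic length $k$; the algebraic length of a weak component is that of the induced subdigraph. *)

theory Defs
  imports "Graph_Theory.Pair_Digraph"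
begin

section \<open>Terms, algebras, varieties\<close>

text \<open>
  A signature is a partial map from operation symbols to arities; symbols mapped to
  \<^term>\<open>None\<close> do not belong to the signature.
\<close>

type_synonym 'f signature = "'f \<Rightarrow> nat option"

datatype (dead 'f, vars: 'v) trm = Var 'v | App 'f "('f, 'v) trm list"
  for map: rename

primrec wf_trm :: "'f signature \<Rightarrow> ('f, 'v) trm \<Rightarrow> bool" where
  "wf_trm sg (Var x) = True"
| "wf_trm sg (App f ts) = (sg f = Some (length ts) \<and> list_all (wf_trm sg) ts)"

definition terms :: "'f signature \<Rightarrow> ('f, nat) trm set" where
  "terms sg = {t. wf_trm sg t}"

text \<open>
  A term of arity \<open>k\<close> uses (not necessarily all of) the variables \<open>0, \<dots>, k - 1\<close>.
  Term operations are taken to have positive arity.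
\<close>

definition terms_of_arity :: "'f signature \<Rightarrow> nat \<Rightarrow> ('f, nat) trm set" where
  "terms_of_arity sg k = {t \<in> terms sg. 0 < k \<and> vars t \<subseteq> {..<k}}"

record ('f, 'a) alg =
  universe :: "'a set"
  opn :: "'f \<Rightarrow> 'a list \<Rightarrow> 'a"

definition is_algebra :: "'f signature \<Rightarrow> ('f, 'a) alg \<Rightarrow> bool" where
  "is_algebra sg A \<longleftrightarrow>
     universe A \<noteq> {} \<and>
     (\<forall>f n as. sg f = Some n \<longrightarrow> length as = n \<longrightarrow> set as \<subseteq> universe A \<longrightarrow> opn A f as \<in> universe A)"

primrec eval :: "('f, 'a) alg \<Rightarrow> ('v \<Rightarrow> 'a) \<Rightarrow> ('f, 'v) trm \<Rightarrow> 'a" where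
  "eval A v (Var x) = v x"
| "eval A v (App f ts) = opn A f (map (eval A v) ts)"

definition satisfies :: "('f, 'a) alg \<Rightarrow> ('f, nat) trm \<Rightarrow> ('f, nat) trm \<Rightarrow> bool" where
  "satisfies A s t \<longleftrightarrow> (\<forall>v. range v \<subseteq> universe A \<longrightarrow> eval A v s = eval A v t)"

text \<open>
  A variety is given by a set of identities \<open>\<Sigma>\<close>.
  The class of its members is available at every carrier type \<open>'a\<close>.
\<close>

definition variety ::
  "'f signature \<Rightarrow> (('f, nat) trm \<times> ('f, nat) trm) set \<Rightarrow> ('f, 'a) alg set" where
  "variety sg \<Sigma> = {A. is_algebra sg A \<and> (\<forall>(s, t) \<in> \<Sigma>. satisfies A s t)}"

text \<open>
  An identity holds in a variety if it holds in all its members. A definition cannot quantify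
  over carrier types, so the members considered are those whose universe is a set of terms;
  by lemma \<open>variety_satisfies_any_type\<close> below the identity then holds in all members, whatever
  their carrier type.
\<close>

definition variety_satisfies ::
  "'f signature \<Rightarrow> (('f, nat) trm \<times> ('f, nat) trm) set \<Rightarrow>
   ('f, nat) trm \<Rightarrow> ('f, nat) trm \<Rightarrow> bool" where
  "variety_satisfies sg \<Sigma> s t \<longleftrightarrow>
     (\<forall>B :: ('f, ('f, nat) trm) alg. B \<in> variety sg \<Sigma> \<longrightarrow> satisfies B s t)"

lemma eval_in_universe:
  assumes "is_algebra sg A" "range v \<subseteq> universe A" "wf_trm sg t"
  shows "eval A v t \<in> universe A"
  using assms(3)
proof (induction t)
  case (Var x)
  then show ?case using assms(2) by auto
next
  case (App f ts)
  then have "set (map (eval A v) ts) \<subseteq> universe A" by (auto simp: list_all_iff)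
  then show ?case using App.prems assms(1) by (auto simp: is_algebra_def)
qed

lemma variety_satisfies_any_type:
  fixes A :: "('f, 'a) alg"
  assumes \<Sigma>: "\<Sigma> \<subseteq> terms sg \<times> terms sg" and s: "s \<in> terms sg" and t: "t \<in> terms sg"
    and sat: "variety_satisfies sg \<Sigma> s t" and A: "A \<in> variety sg \<Sigma>"
  shows "satisfies A s t"
  unfolding satisfies_def
proof (intro allI impI)
  fix v :: "nat \<Rightarrow> 'a"
  assume v: "range v \<subseteq> universe A"
  have algA: "is_algebra sg A" using A by (simp add: variety_def)
  define ev where "ev = eval A v"
  define rep where "rep x = (SOME u. u \<in> terms sg \<and> ev u = x)" for x
  define U where "U = rep ` ev ` terms sg"
  define B where "B = \<lparr>universe = U, opn = (\<lambda>f us. rep (opn A f (map ev us)))\<rparr>"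
  have rep: "rep (ev u) \<in> terms sg \<and> ev (rep (ev u)) = ev u" if "u \<in> terms sg" for u
    unfolding rep_def by (rule someI[of _ u]) (use that in auto)
  have U: "u \<in> terms sg" "rep (ev u) = u" if "u \<in> U" for u
    using that rep unfolding U_def by auto
  have AppU: "App f us \<in> terms sg" if "sg f = Some (length us)" "set us \<subseteq> U" for f us
    using that U by (auto simp: terms_def list_all_iff)
  have opnB: "opn B f us = rep (ev (App f us))" for f us
    by (simp add: B_def ev_def)
  have algB: "is_algebra sg B"
    unfolding is_algebra_def
  proof (intro conjI allI impI)
    show "universe B \<noteq> {}"
      by (auto simp: B_def U_def terms_def intro: exI[of _ "Var 0"])
  next
    fix f n us
    assume "sg f = Some n" "length us = n" "set us \<subseteq> universe B"
    then have "App f us \<in> terms sg" by (intro AppU) (auto simp: B_def)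
    then have "opn B f us \<in> U" unfolding opnB U_def by blast
    then show "opn B f us \<in> universe B" by (simp add: B_def)
  qed
  have hom: "ev (eval B w p) = eval A (ev \<circ> w) p"
    if w: "range w \<subseteq> universe B" and p: "wf_trm sg p" for w :: "nat \<Rightarrow> _" and p
    using p
  proof (induction p)
    case (Var x)
    then show ?case by simp
  next
    case (App f ts)
    have "set (map (eval B w) ts) \<subseteq> U"
      using App.prems eval_in_universe[OF algB w] by (auto simp: list_all_iff B_def)
    then have "App f (map (eval B w) ts) \<in> terms sg"
      using App.prems by (intro AppU) auto
    then have "ev (eval B w (App f ts)) = ev (App f (map (eval B w) ts))"
      using rep by (simp add: opnB)
    also have "\<dots> = opn A f (map (\<lambda>u. ev (eval B w u)) ts)"
      by (simp add: ev_def comp_def)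
    also have "\<dots> = opn A f (map (eval A (ev \<circ> w)) ts)"
      using App by (intro arg_cong[of _ _ "opn A f"]) (auto simp: list_all_iff comp_def)
    finally show ?case by (simp add: comp_def)
  qed
  have "satisfies B p q" if pq: "(p, q) \<in> \<Sigma>" for p q
    unfolding satisfies_def
  proof (intro allI impI)
    fix w :: "nat \<Rightarrow> ('f, nat) trm"
    assume w: "range w \<subseteq> universe B"
    have wf: "wf_trm sg p" "wf_trm sg q" using pq \<Sigma> by (auto simp: terms_def)
    have "range (ev \<circ> w) \<subseteq> universe A"
    proof safe
      fix i
      have "wf_trm sg (w i)" using w U(1)[of "w i"] by (auto simp: B_def terms_def)
      then show "(ev \<circ> w) i \<in> universe A"
        using eval_in_universe[OF algA v] by (simp add: ev_def)
    qed
    then have "eval A (ev \<circ> w) p = eval A (ev \<circ> w) q"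
      using A pq by (auto simp: variety_def satisfies_def)
    then have "rep (ev (eval B w p)) = rep (ev (eval B w q))"
      using hom[OF w] wf by simp
    moreover have "eval B w p \<in> U" "eval B w q \<in> U"
      using eval_in_universe[OF algB w] wf by (auto simp: B_def)
    ultimately show "eval B w p = eval B w q" using U(2) by metis
  qed
  then have "B \<in> variety sg \<Sigma>" using algB by (auto simp: variety_def)
  then have satB: "satisfies B s t" using sat by (simp add: variety_satisfies_def)
  define w where "w n = rep (v n)" for n
  have vn: "v n = ev (Var n)" for n by (simp add: ev_def)
  have Varn: "Var n \<in> terms sg" for n by (simp add: terms_def)
  have w: "range w \<subseteq> universe B"
    unfolding w_def vn B_def U_def using Varn by auto
  have evw: "ev \<circ> w = v"
    using rep[OF Varn] by (auto simp: fun_eq_iff w_def vn)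
  have "ev (eval B w s) = ev (eval B w t)" using satB w by (simp add: satisfies_def)
  then show "eval A v s = eval A v t"
    using hom[OF w, unfolded evw] s t by (simp add: terms_def)
qed

section \<open>Taylor varieties\<close>

text \<open>
  The variables \<open>x\<close> and \<open>y\<close> of two-variable identities are \<^term>\<open>Var 0\<close> and \<^term>\<open>Var 1\<close>;
  \<^term>\<open>rename p t\<close> is \<open>t(p 0, \<dots>, p (k - 1))\<close>.
\<close>

definition idempotent_term ::
  "'f signature \<Rightarrow> (('f, nat) trm \<times> ('f, nat) trm) set \<Rightarrow> ('f, nat) trm \<Rightarrow> bool" where
  "idempotent_term sg \<Sigma> t \<longleftrightarrow> variety_satisfies sg \<Sigma> (rename (\<lambda>_. 0) t) (Var 0)"

definition taylor_term ::
  "'f signature \<Rightarrow> (('f, nat) trm \<times> ('f, nat) trm) set \<Rightarrow> nat \<Rightarrow> ('f, nat) trm \<Rightarrow> bool" where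
  "taylor_term sg \<Sigma> k t \<longleftrightarrow>
     t \<in> terms_of_arity sg k \<and>
     idempotent_term sg \<Sigma> t \<and>
     (\<forall>j<k. \<exists>p q. (\<forall>i<k. p i \<in> {0, 1} \<and> q i \<in> {0, 1}) \<and> p j = 0 \<and> q j = 1 \<and>
        variety_satisfies sg \<Sigma> (rename p t) (rename q t))"

definition idempotent_variety ::
  "'f signature \<Rightarrow> (('f, nat) trm \<times> ('f, nat) trm) set \<Rightarrow> bool" where
  "idempotent_variety sg \<Sigma> \<longleftrightarrow> (\<forall>t \<in> terms sg. idempotent_term sg \<Sigma> t)"

definition taylor_variety ::
  "'f signature \<Rightarrow> (('f, nat) trm \<times> ('f, nat) trm) set \<Rightarrow> bool" where
  "taylor_variety sg \<Sigma> \<longleftrightarrow> idempotent_variety sg \<Sigma> \<and> (\<exists>k t. taylor_term sg \<Sigma> k t)"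

section \<open>Subuniverses and absorption\<close>

definition subuniverse :: "'f signature \<Rightarrow> ('f, 'a) alg \<Rightarrow> 'a set \<Rightarrow> bool" where
  "subuniverse sg A B \<longleftrightarrow>
     B \<subseteq> universe A \<and>
     (\<forall>f n as. sg f = Some n \<longrightarrow> length as = n \<longrightarrow> set as \<subseteq> B \<longrightarrow> opn A f as \<in> B)"

definition alg_square :: "('f, 'a) alg \<Rightarrow> ('f, 'a \<times> 'a) alg" where
  "alg_square A =
     \<lparr>universe = universe A \<times> universe A,
      opn = (\<lambda>f ps. (opn A f (map fst ps), opn A f (map snd ps)))\<rparr>"

definition absorbing_subuniverse :: "'f signature \<Rightarrow> ('f, 'a) alg \<Rightarrow> 'a set \<Rightarrow> bool" where
  "absorbing_subuniverse sg A B \<longleftrightarrow>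
     subuniverse sg A B \<and>
     (\<exists>n. \<exists>t \<in> terms_of_arity sg n. \<forall>k<n. \<forall>a :: nat \<Rightarrow> 'a.
        (\<forall>i<n. a i \<in> universe A) \<longrightarrow> (\<forall>i<n. i \<noteq> k \<longrightarrow> a i \<in> B) \<longrightarrow> eval A a t \<in> B)"

definition minimal_absorbing_subuniverse :: "'f signature \<Rightarrow> ('f, 'a) alg \<Rightarrow> 'a set \<Rightarrow> bool" where
  "minimal_absorbing_subuniverse sg A J \<longleftrightarrow>
     J \<noteq> {} \<and> absorbing_subuniverse sg A J \<and>
     \<not> (\<exists>J'. J' \<noteq> {} \<and> J' \<subset> J \<and> absorbing_subuniverse sg A J')"

section \<open>Digraphs, oriented paths, algebraic length\<close>

definition smooth :: "'v pair_pre_digraph \<Rightarrow> bool" where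
  "smooth G \<longleftrightarrow>
     (\<forall>v \<in> pverts G. (\<exists>u. (u, v) \<in> parcs G) \<and> (\<exists>w. (v, w) \<in> parcs G))"

definition digraph_hom ::
  "'u pair_pre_digraph \<Rightarrow> 'v pair_pre_digraph \<Rightarrow> ('u \<Rightarrow> 'v) \<Rightarrow> bool" where
  "digraph_hom H G h \<longleftrightarrow>
     h ` pverts H \<subseteq> pverts G \<and> (\<forall>(u, v) \<in> parcs H. (h u, h v) \<in> parcs G)"

text \<open>
  Up to isomorphism, an oriented path with \<open>k\<close> edges is determined by the list of directions of
  its edges (\<^term>\<open>True\<close> for forward); its vertices are \<open>0, \<dots>, k\<close>.
\<close>

definition oriented_path :: "bool list \<Rightarrow> nat pair_pre_digraph" where
  "oriented_path ds =
     \<lparr>pverts = {..length ds},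
      parcs = {if ds ! i then (i, Suc i) else (Suc i, i) | i. i < length ds}\<rparr>"

definition path_alg_length :: "bool list \<Rightarrow> int" where
  "path_alg_length ds = int (count_list ds True) - int (count_list ds False)"

definition connected_via :: "'v pair_pre_digraph \<Rightarrow> bool list \<Rightarrow> 'v \<Rightarrow> 'v \<Rightarrow> bool" where
  "connected_via G ds a b \<longleftrightarrow>
     (\<exists>h. digraph_hom (oriented_path ds) G h \<and> h 0 = a \<and> h (length ds) = b)"

definition weak_components :: "'v pair_pre_digraph \<Rightarrow> 'v set set" where
  "weak_components G =
     pverts G // {(a, b). a \<in> pverts G \<and> b \<in> pverts G \<and> (\<exists>ds. connected_via G ds a b)}"

definition induced_digraph :: "'v pair_pre_digraph \<Rightarrow> 'v set \<Rightarrow> 'v pair_pre_digraph" where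
  "induced_digraph G W = \<lparr>pverts = W, parcs = parcs G \<inter> W \<times> W\<rparr>"

definition closed_alg_length :: "'v pair_pre_digraph \<Rightarrow> nat \<Rightarrow> bool" where
  "closed_alg_length G k \<longleftrightarrow>
     (\<exists>a \<in> pverts G. \<exists>ds. path_alg_length ds = int k \<and> connected_via G ds a a)"

definition has_alg_length :: "'v pair_pre_digraph \<Rightarrow> nat \<Rightarrow> bool" where
  "has_alg_length G k \<longleftrightarrow>
     0 < k \<and> closed_alg_length G k \<and> (\<forall>j. 0 < j \<and> j < k \<longrightarrow> \<not> closed_alg_length G j)"

end

theory Submission
  imports Defs
begin

text \<open>
  A digraph is linked if the relation ``having a common successor'' connects all its vertices. In a
  finite smooth digraph, passing to predecessors permutes the classes of the relation ``linked in
  some power of \<open>E\<close>'', so a component of algebraic length one is a single class, and some power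
  \<open>E ^^ m\<close> is linked on it. A loop is then found by induction on the number of vertices.

  If there is a proper absorbing subuniverse, linkedness of \<open>E ^^ m\<close> yields a proper absorbing \<open>K\<close>
  whose vertices all have a successor (or all have a predecessor) in \<open>K\<close>. Its smooth part is absorbing,
  and the absorbing operation turns fences of the whole digraph into fences of the smooth part.

  If there is none, then there is a transitive operation \<open>s\<close>: any value is attained with any prescribed
  element at any prescribed coordinate. Otherwise some proper \<open>D\<close> would be such that every operation
  has a coordinate at which \<open>D\<close> forces a value in \<open>D\<close>, and a Taylor identity at that coordinate would
  give a binary operation absorbing into \<open>D\<close>. By means of \<open>s\<close> the centre of a relation is absorbing,
  hence linked compatible relations are full. So \<open>E ^^ Suc k\<close> is full and \<open>E ^^ k\<close> is not linked for
  some \<open>k\<close>. Unless \<open>k = 0\<close>, the bi-infinite walks inside one linkedness block of \<open>E ^^ k\<close> cover a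
  proper smooth subuniverse, again with a linked power.
\<close>

text \<open>An operation takes an infinite sequence of which only an initial segment matters, so its
  arity is not visible in its type. Hence \<open>F\<close> is a family indexed by arity, and all
  conditions are bounded by \<open>i < n\<close>.\<close>

definition closed_under :: "(nat \<Rightarrow> ((nat \<Rightarrow> 'a) \<Rightarrow> 'a) set) \<Rightarrow> 'a set \<Rightarrow> bool" where
  "closed_under F B \<longleftrightarrow> (\<forall>n. \<forall>f\<in>F n. \<forall>a. (\<forall>i<n. a i \<in> B) \<longrightarrow> f a \<in> B)"

definition compatible :: "(nat \<Rightarrow> ((nat \<Rightarrow> 'a) \<Rightarrow> 'a) set) \<Rightarrow> 'a rel \<Rightarrow> bool" where
  "compatible F R \<longleftrightarrow>
     (\<forall>n. \<forall>f\<in>F n. \<forall>a b. (\<forall>i<n. (a i, b i) \<in> R) \<longrightarrow> (f a, f b) \<in> R)"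

text \<open>Star composition: \<open>f\<close> applied to copies of \<open>g\<close> on disjoint
  blocks of \<open>m\<close> variables. Variable \<open>w\<close> is at position
  \<open>w mod m\<close> of block \<open>w div m\<close>.\<close>

definition star :: "nat \<Rightarrow> ((nat \<Rightarrow> 'a) \<Rightarrow> 'a) \<Rightarrow> ((nat \<Rightarrow> 'a) \<Rightarrow> 'a) \<Rightarrow> (nat \<Rightarrow> 'a) \<Rightarrow> 'a" where
  "star m f g = (\<lambda>a. f (\<lambda>i. g (\<lambda>j. a (i * m + j))))"

definition absorbs_by :: "'a set \<Rightarrow> nat \<Rightarrow> ((nat \<Rightarrow> 'a) \<Rightarrow> 'a) \<Rightarrow> 'a set \<Rightarrow> bool" where
  "absorbs_by A n f B \<longleftrightarrow>
     (\<forall>k<n. \<forall>a. (\<forall>i<n. a i \<in> A) \<longrightarrow> (\<forall>i<n. i \<noteq> k \<longrightarrow> a i \<in> B) \<longrightarrow> f a \<in> B)"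

definition absorbing :: "(nat \<Rightarrow> ((nat \<Rightarrow> 'a) \<Rightarrow> 'a) set) \<Rightarrow> 'a set \<Rightarrow> 'a set \<Rightarrow> bool" where
  "absorbing F A B \<longleftrightarrow> B \<subseteq> A \<and> closed_under F B \<and> (\<exists>n. \<exists>f\<in>F n. absorbs_by A n f B)"

definition minimal_absorbing :: "(nat \<Rightarrow> ((nat \<Rightarrow> 'a) \<Rightarrow> 'a) set) \<Rightarrow> 'a set \<Rightarrow> 'a set \<Rightarrow> bool" where
  "minimal_absorbing F A J \<longleftrightarrow>
     J \<noteq> {} \<and> absorbing F A J \<and> \<not> (\<exists>J'. J' \<noteq> {} \<and> J' \<subset> J \<and> absorbing F A J')"

definition smooth_on :: "'a set \<Rightarrow> 'a rel \<Rightarrow> bool" where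
  "smooth_on A E \<longleftrightarrow>
     E \<subseteq> A \<times> A \<and> (\<forall>x\<in>A. \<exists>y. (x, y) \<in> E) \<and> (\<forall>x\<in>A. \<exists>y. (y, x) \<in> E)"

text \<open>The reflexive transitive closure of \<open>link R\<close> is left linkedness of
  \<open>R\<close>; \<open>link (R\<inverse>)\<close> yields right linkedness, by common
  predecessors.\<close>

definition link :: "'a rel \<Rightarrow> 'a rel" where
  "link R = R O R\<inverse>"

definition transitive_op :: "'a set \<Rightarrow> nat \<Rightarrow> ((nat \<Rightarrow> 'a) \<Rightarrow> 'a) \<Rightarrow> bool" where
  "transitive_op A n s \<longleftrightarrow>
     (\<forall>w<n. \<forall>b\<in>A. \<forall>c\<in>A. \<exists>a. (\<forall>i<n. a i \<in> A) \<and> a w = b \<and> s a = c)"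

text \<open>\<open>p\<close> and \<open>q\<close> are the argument patterns of the two sides of the
  Taylor identity at \<open>j\<close>; \<open>a 0\<close> and \<open>a 1\<close> are the values of
  its variables x and y.\<close>

definition taylor_op :: "'a set \<Rightarrow> nat \<Rightarrow> ((nat \<Rightarrow> 'a) \<Rightarrow> 'a) \<Rightarrow> bool" where
  "taylor_op A n t \<longleftrightarrow>
     (\<forall>j<n. \<exists>p q :: nat \<Rightarrow> nat. (\<forall>i<n. p i < 2 \<and> q i < 2) \<and> p j = 0 \<and> q j = 1 \<and>
        (\<forall>a. a 0 \<in> A \<longrightarrow> a 1 \<in> A \<longrightarrow> t (\<lambda>i. a (p i)) = t (\<lambda>i. a (q i))))"

section \<open>Relations, walks and links\<close>

lemma closed_underD: "closed_under F B \<Longrightarrow> f \<in> F n \<Longrightarrow> (\<And>i. i < n \<Longrightarrow> a i \<in> B) \<Longrightarrow> f a \<in> B"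
  by (auto simp: closed_under_def)

lemma compatibleD:
  "compatible F R \<Longrightarrow> f \<in> F n \<Longrightarrow> (\<And>i. i < n \<Longrightarrow> (a i, b i) \<in> R) \<Longrightarrow> (f a, f b) \<in> R"
  by (auto simp: compatible_def)

lemma absorbs_byD:
  "absorbs_by A n f B \<Longrightarrow> k < n \<Longrightarrow> (\<And>i. i < n \<Longrightarrow> a i \<in> A) \<Longrightarrow>
    (\<And>i. i < n \<Longrightarrow> i \<noteq> k \<Longrightarrow> a i \<in> B) \<Longrightarrow> f a \<in> B"
  by (auto simp: absorbs_by_def)

lemma compatible_converse: "compatible F R \<Longrightarrow> compatible F (R\<inverse>)"
  by (auto simp: compatible_def)

lemma compatible_relcomp:
  assumes "compatible F R" "compatible F S"
  shows "compatible F (R O S)"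
  unfolding compatible_def
proof (intro allI ballI impI)
  fix n f a b
  assume f: "f \<in> F n" and ab: "\<forall>i<n. (a i, b i) \<in> R O S"
  then have "\<forall>i. \<exists>c. i < n \<longrightarrow> (a i, c) \<in> R \<and> (c, b i) \<in> S" by blast
  then obtain c where "\<And>i. i < n \<Longrightarrow> (a i, c i) \<in> R \<and> (c i, b i) \<in> S" by metis
  then have "(f a, f c) \<in> R" "(f c, f b) \<in> S" using f assms by (auto intro: compatibleD)
  then show "(f a, f b) \<in> R O S" by blast
qed

lemma compatible_link: "compatible F R \<Longrightarrow> compatible F (link R)"
  by (simp add: link_def compatible_relcomp compatible_converse)

lemma compatible_Int_Times: "compatible F R \<Longrightarrow> closed_under F B \<Longrightarrow> compatible F (R \<inter> B \<times> B)"
  by (auto simp: compatible_def closed_under_def)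

lemma relpow_pos_subset: "E \<subseteq> A \<times> A \<Longrightarrow> 0 < n \<Longrightarrow> E ^^ n \<subseteq> A \<times> A"
proof (induction n)
  case (Suc n)
  then show ?case by (cases n) auto
qed simp

lemma relpow_subset_mono:
  fixes R S :: "'a rel"
  assumes "R \<subseteq> S"
  shows "R ^^ n \<subseteq> S ^^ n"
  by (induction n) (use assms in auto)

lemma relpow_succ_ex:
  assumes "E \<subseteq> A \<times> A" "\<And>x. x \<in> A \<Longrightarrow> \<exists>y. (x, y) \<in> E" "x \<in> A"
  shows "\<exists>y\<in>A. (x, y) \<in> E ^^ n"
proof (induction n)
  case (Suc n)
  then obtain y where "y \<in> A" "(x, y) \<in> E ^^ n" by blast
  moreover from assms \<open>y \<in> A\<close> obtain z where "(y, z) \<in> E" "z \<in> A" by blast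
  ultimately show ?case by auto
qed (use assms in auto)

lemma smooth_on_converse: "smooth_on A (E\<inverse>) \<longleftrightarrow> smooth_on A E"
  by (auto simp: smooth_on_def)

lemma smooth_on_succ: "smooth_on A E \<Longrightarrow> x \<in> A \<Longrightarrow> \<exists>y\<in>A. (x, y) \<in> E ^^ n"
  by (rule relpow_succ_ex) (auto simp: smooth_on_def)

lemma relpow_converse:
  fixes E :: "'a rel"
  shows "(E\<inverse>) ^^ n = (E ^^ n)\<inverse>"
proof (induction n)
  case (Suc n)
  have "(E\<inverse>) ^^ Suc n = (E ^^ n)\<inverse> O E\<inverse>" using Suc by simp
  also have "\<dots> = (E O E ^^ n)\<inverse>" by auto
  also have "E O E ^^ n = E ^^ Suc n" by (simp add: relpow_commute)
  finally show ?case .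
qed auto

lemma smooth_on_pred: "smooth_on A E \<Longrightarrow> x \<in> A \<Longrightarrow> \<exists>y\<in>A. (y, x) \<in> E ^^ n"
  using smooth_on_succ[of A "E\<inverse>" x n] by (simp add: smooth_on_converse relpow_converse)

lemma sym_link: "sym (link R)"
  by (auto simp: sym_def link_def)

lemma sym_link_rtrancl: "(x, y) \<in> (link R)\<^sup>* \<Longrightarrow> (y, x) \<in> (link R)\<^sup>*"
  by (meson sym_link sym_rtrancl symD)

text \<open>Each right link has a common predecessor, and the predecessors chosen for two
  consecutive links share a successor. So a chain of right links turns into a chain of left links
  between predecessors.\<close>

lemma link_rtrancl_transfer:
  assumes "(x', y') \<in> (link (R\<inverse>))\<^sup>*" "(x, x') \<in> R" "(y, y') \<in> R"
  shows "(x, y) \<in> (link R)\<^sup>*"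
  using assms(1,3)
proof (induction arbitrary: y rule: rtrancl_induct)
  case base
  then show ?case using assms(2) by (auto simp: link_def)
next
  case (step u v)
  then obtain w where w: "(w, u) \<in> R" "(w, v) \<in> R" by (auto simp: link_def)
  then have "(x, w) \<in> (link R)\<^sup>*" using step by blast
  moreover have "(w, y) \<in> link R" using w step by (auto simp: link_def)
  ultimately show ?case by simp
qed

text \<open>Both walks are prolonged beyond their common end by the same walk.\<close>

lemma link_relpow_mono:
  assumes E: "E \<subseteq> A \<times> A" "\<And>x. x \<in> A \<Longrightarrow> \<exists>y. (x, y) \<in> E"
    and "x \<in> A" "(x, y) \<in> link (E ^^ i)" "i \<le> j"
  shows "(x, y) \<in> link (E ^^ j)"
proof -
  obtain c where c: "(x, c) \<in> E ^^ i" "(y, c) \<in> E ^^ i" using assms by (auto simp: link_def)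
  have "c \<in> A" using assms(3) c relpow_pos_subset[OF E(1), of i] by (cases i) auto
  then obtain d where "(c, d) \<in> E ^^ (j - i)" using relpow_succ_ex[OF E] by blast
  then have "(x, d) \<in> E ^^ (i + (j - i))" "(y, d) \<in> E ^^ (i + (j - i))"
    using c unfolding relpow_add by blast+
  then show ?thesis using assms by (auto simp: link_def)
qed

lemma rtrancl_link_closed:
  assumes "E \<subseteq> A \<times> A" "(x, y) \<in> (link (E ^^ n))\<^sup>*" "x \<in> A"
  shows "y \<in> A"
  using assms(2,3)
proof (induction rule: rtrancl_induct)
  case (step y z)
  then show ?case using assms(1) relpow_pos_subset[of E A n]
    by (cases n) (auto simp: link_def)
qed

lemma relpow_refl_mono:
  assumes R: "R \<subseteq> X \<times> X" "\<And>x. x \<in> X \<Longrightarrow> (x, x) \<in> R" and x: "x \<in> X"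
    and xy: "(x, y) \<in> R ^^ l" and "l \<le> L"
  shows "(x, y) \<in> R ^^ L"
  using \<open>l \<le> L\<close>
proof (induction L rule: dec_induct)
  case base
  then show ?case by (rule xy)
next
  case (step L)
  have "y \<in> X" using x R(1) xy relpow_pos_subset[of R X l] by (cases l) auto
  then show ?case using step R(2) by auto
qed

text \<open>Loops pad shorter walks, so the maximal length serves all of the finitely many
  pairs.\<close>

lemma rtrancl_uniform:
  assumes R: "R \<subseteq> A \<times> A" "\<And>x. x \<in> A \<Longrightarrow> (x, x) \<in> R"
    and "finite X" "X \<subseteq> A \<times> A" "X \<subseteq> R\<^sup>*"
  shows "\<exists>k. X \<subseteq> R ^^ k"
  using assms(3-)
proof (induction X rule: finite_induct)
  case (insert p X)
  then obtain k where k: "X \<subseteq> R ^^ k" by blast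
  obtain l where l: "p \<in> R ^^ l" using insert by (auto simp: rtrancl_power)
  have "q \<in> R ^^ (max k l)" if "q \<in> insert p X" for q
  proof -
    have "fst q \<in> A" using that insert.prems by auto
    moreover have "\<exists>i\<le>max k l. q \<in> R ^^ i"
      using that k l by (auto intro: max.cobounded1 max.cobounded2)
    ultimately show ?thesis using relpow_refl_mono[OF R, of "fst q" "snd q"] by auto
  qed
  then show ?case by blast
qed simp

lemma walk_relpow:
  assumes "\<And>i. i < n \<Longrightarrow> (p i, p (Suc i)) \<in> R" "i \<le> j" "j \<le> n"
  shows "(p i, p j) \<in> R ^^ (j - i)"
  using assms(2,3)
proof (induction j rule: dec_induct)
  case (step j)
  then show ?case using assms(1)[of j] by (auto simp: Suc_diff_le)
qed simp

lemma walk_choice: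
  assumes "\<And>i x. x \<in> A \<Longrightarrow> \<exists>y\<in>A. (x, y) \<in> R \<and> Q i y" "x \<in> A"
  shows "\<exists>p. p 0 = x \<and> (\<forall>i. p i \<in> A \<and> (p i, p (Suc i)) \<in> R \<and> Q i (p (Suc i)))"
proof -
  have "\<exists>p. \<forall>i. (p i \<in> A \<and> (i = 0 \<longrightarrow> p i = x)) \<and> ((p i, p (Suc i)) \<in> R \<and> Q i (p (Suc i)))"
    by (rule dependent_nat_choice[where P = "\<lambda>i y. y \<in> A \<and> (i = 0 \<longrightarrow> y = x)" and
          Q = "\<lambda>i y z. (y, z) \<in> R \<and> Q i z"]) (use assms in auto)
  then show ?thesis by blast
qed

text \<open>The operation is applied to \<open>n\<close> walks of equal length, step by step. The
  relation may depend on the coordinate, because for absorption one walk runs in the whole digraph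
  and the others in a subset. \<open>local\<close> settles length 0, where \<open>a\<close> and
  \<open>b\<close> agree only below \<open>n\<close>.\<close>

lemma relpow_family:
  assumes "\<And>a b. (\<And>i. i < n \<Longrightarrow> (a i, b i) \<in> R i) \<Longrightarrow> (f a, f b) \<in> S"
    and local: "\<And>a b. (\<And>i. i < n \<Longrightarrow> a i = b i) \<Longrightarrow> f a = f b"
    and "\<And>i. i < n \<Longrightarrow> (a i, b i) \<in> R i ^^ L"
  shows "(f a, f b) \<in> S ^^ L"
  using assms(3)
proof (induction L arbitrary: b)
  case 0
  then show ?case using local[of a b] by simp
next
  case (Suc L)
  then have "\<forall>i. \<exists>c. i < n \<longrightarrow> (a i, c) \<in> R i ^^ L \<and> (c, b i) \<in> R i" by fastforce
  then obtain c where "\<And>i. i < n \<Longrightarrow> (a i, c i) \<in> R i ^^ L \<and> (c i, b i) \<in> R i" by metis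
  then show ?case using Suc.IH[of c] assms(1)[of c b] by auto
qed

text \<open>Reflexivity allows padding all walks to one length, for which the sum of the individual
  lengths is large enough.\<close>

lemma rtrancl_family:
  fixes n :: nat
  assumes step: "\<And>a b. (\<And>i. i < n \<Longrightarrow> (a i, b i) \<in> R i) \<Longrightarrow> (f a, f b) \<in> S"
    and local: "\<And>a b. (\<And>i. i < n \<Longrightarrow> a i = b i) \<Longrightarrow> f a = f b"
    and X: "\<And>i. i < n \<Longrightarrow> R i \<subseteq> X i \<times> X i" "\<And>i x. i < n \<Longrightarrow> x \<in> X i \<Longrightarrow> (x, x) \<in> R i"
      "\<And>i. i < n \<Longrightarrow> a i \<in> X i"
    and ab: "\<And>i. i < n \<Longrightarrow> (a i, b i) \<in> (R i)\<^sup>*"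
  shows "(f a, f b) \<in> S\<^sup>*"
proof -
  have "\<forall>i. \<exists>l. i < n \<longrightarrow> (a i, b i) \<in> R i ^^ l" using ab by (metis rtrancl_imp_relpow)
  then obtain l where l: "\<And>i. i < n \<Longrightarrow> (a i, b i) \<in> R i ^^ l i" by metis
  define L where "L = (\<Sum>i<n. l i)"
  have "(a i, b i) \<in> R i ^^ L" if "i < n" for i
    by (rule relpow_refl_mono[of "R i" "X i" _ _ "l i"])
      (use that X l in \<open>auto simp: L_def intro!: member_le_sum\<close>)
  with step local have "(f a, f b) \<in> S ^^ L" by (rule relpow_family)
  then show ?thesis by (rule relpow_imp_rtrancl)
qed

lemma compatible_relpow:
  assumes "compatible F R" "\<And>f n a b. f \<in> F n \<Longrightarrow> (\<And>i. i < n \<Longrightarrow> a i = b i) \<Longrightarrow> f a = f b"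
  shows "compatible F (R ^^ m)"
  unfolding compatible_def
proof (intro allI ballI impI)
  fix n f a b
  assume f: "f \<in> F n" and ab: "\<forall>i<n. (a i, b i) \<in> R ^^ m"
  show "(f a, f b) \<in> R ^^ m"
    by (rule relpow_family[of n "\<lambda>_. R"]) (use f ab assms in \<open>auto intro: compatibleD\<close>)
qed

section \<open>Trimming a finite set of vertices to a smooth part\<close>

lemma eventually_constant_decreasing:
  fixes V :: "nat \<Rightarrow> 'a set"
  assumes "finite (V 0)" "\<And>m. V (Suc m) \<subseteq> V m"
  shows "\<exists>M. \<forall>m\<ge>M. V m = V M"
proof -
  define M where "M = arg_min (\<lambda>m. card (V m)) (\<lambda>_. True)"
  have anti: "V m \<subseteq> V l" if "l \<le> m" for l m
    using that by (induction rule: dec_induct) (use assms in auto)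
  have "card (V M) \<le> card (V m)" for m
    unfolding M_def by (rule arg_min_nat_le) simp
  moreover have "finite (V m)" for m using anti[of 0 m] assms(1) finite_subset by blast
  ultimately have "V m = V M" if "m \<ge> M" for m
    using anti[OF that] by (meson card_seteq)
  then show ?thesis by blast
qed

text \<open>\<open>V m\<close> consists of the ends of walks of length \<open>m\<close> inside
  \<open>K\<close>. The sequence decreases; once it is stable, \<open>V M\<close> is the set of its
  own successors in \<open>K\<close>, which gives predecessors, while \<open>out\<close> gives
  successors. Quantifying over all \<open>m \<ge> M\<close> leaves later arguments free to take
  longer walks.\<close>

lemma trim_out_smooth:
  fixes E :: "'a rel" and K :: "'a set"
  defines "V \<equiv> \<lambda>m. ((E \<inter> K \<times> K) ^^ m) `` K"
  assumes "finite K" "K \<noteq> {}" and out: "\<And>x. x \<in> K \<Longrightarrow> \<exists>y\<in>K. (x, y) \<in> E"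
  shows "\<exists>M. \<forall>m\<ge>M. V m = V M \<and> V M \<noteq> {} \<and> V M \<subseteq> K \<and> smooth_on (V M) (E \<inter> V M \<times> V M) \<and>
    (\<forall>x\<in>V M. \<forall>y\<in>K. (x, y) \<in> E \<longrightarrow> y \<in> V M)"
proof -
  let ?R = "E \<inter> K \<times> K"
  have V_Suc: "V (Suc m) = ?R `` V m" for m by (auto simp: V_def)
  have V_sub: "V m \<subseteq> K" for m by (cases m) (auto simp: V_def)
  have mono: "V (Suc m) \<subseteq> V m" for m
  proof
    fix x assume "x \<in> V (Suc m)"
    then obtain a where "a \<in> K" "(a, x) \<in> ?R O ?R ^^ m"
      by (auto simp: V_def relpow_commute)
    then show "x \<in> V m" by (auto simp: V_def)
  qed
  have "finite (V 0)" using assms by (auto simp: V_def)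
  from eventually_constant_decreasing[of V, OF this mono] obtain M where
    M: "\<And>m. m \<ge> M \<Longrightarrow> V m = V M" by blast
  have ne: "V m \<noteq> {}" for m
  proof (induction m)
    case 0
    then show ?case using assms by (auto simp: V_def)
  next
    case (Suc m)
    then obtain x where "x \<in> V m" by blast
    moreover from this V_sub out obtain y where "y \<in> K" "(x, y) \<in> E" by blast
    ultimately show ?case using V_sub unfolding V_Suc by blast
  qed
  have step: "?R `` V M = V M" using M[of "Suc M"] V_Suc by simp
  then have fwd: "y \<in> V M" if "x \<in> V M" "y \<in> K" "(x, y) \<in> E" for x y
    using that V_sub by blast
  have "smooth_on (V M) (E \<inter> V M \<times> V M)"
    unfolding smooth_on_def
  proof (intro conjI ballI)
    fix x assume x: "x \<in> V M"
    then obtain y where "y \<in> K" "(x, y) \<in> E" using out V_sub by blast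
    then show "\<exists>y. (x, y) \<in> E \<inter> V M \<times> V M" using x fwd by blast
    from x step show "\<exists>y. (y, x) \<in> E \<inter> V M \<times> V M" by blast
  qed simp
  then show ?thesis using ne V_sub fwd by (intro exI[of _ M] allI impI conjI ballI M) blast+
qed

lemma taylor_opE:
  assumes "taylor_op A n t" "j < n"
  obtains p q :: "nat \<Rightarrow> nat" where "\<And>i. i < n \<Longrightarrow> p i < 2" "\<And>i. i < n \<Longrightarrow> q i < 2"
    "p j = 0" "q j = 1"
    "\<And>a. a 0 \<in> A \<Longrightarrow> a 1 \<in> A \<Longrightarrow> t (\<lambda>i. a (p i)) = t (\<lambda>i. a (q i))"
proof -
  from assms obtain p q :: "nat \<Rightarrow> nat" where "(\<forall>i<n. p i < 2 \<and> q i < 2) \<and> p j = 0 \<and> q j = 1 \<and>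
        (\<forall>a. a 0 \<in> A \<longrightarrow> a 1 \<in> A \<longrightarrow> t (\<lambda>i. a (p i)) = t (\<lambda>i. a (q i)))"
    unfolding taylor_op_def by blast
  then show thesis by (intro that[of p q]) blast+
qed

lemma taylor_op_mono:
  assumes "taylor_op A n t" "B \<subseteq> A"
  shows "taylor_op B n t"
  unfolding taylor_op_def
proof (intro allI impI)
  fix j assume "j < n"
  with assms(1) obtain p q :: "nat \<Rightarrow> nat" where "\<And>i. i < n \<Longrightarrow> p i < 2" "\<And>i. i < n \<Longrightarrow> q i < 2"
    "p j = 0" "q j = 1"
    "\<And>a. a 0 \<in> A \<Longrightarrow> a 1 \<in> A \<Longrightarrow> t (\<lambda>i. a (p i)) = t (\<lambda>i. a (q i))"
    by (rule taylor_opE) blast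
  then show "\<exists>p q :: nat \<Rightarrow> nat. (\<forall>i<n. p i < 2 \<and> q i < 2) \<and> p j = 0 \<and> q j = 1 \<and>
        (\<forall>a. a 0 \<in> B \<longrightarrow> a 1 \<in> B \<longrightarrow> t (\<lambda>i. a (p i)) = t (\<lambda>i. a (q i)))"
    using assms(2) by (intro exI[of _ p] exI[of _ q]) blast
qed

section \<open>Clones with a Taylor operation\<close>

text \<open>The operations are defined on the whole type, so one family \<open>F\<close> serves all
  subuniverses: \<open>restrict\<close> changes only \<open>A\<close>. Closure under composition is
  stated through variable substitutions (\<open>minor\<close>) and \<open>star\<close>.\<close>

locale taylor_clone =
  fixes F :: "nat \<Rightarrow> ((nat \<Rightarrow> 'a) \<Rightarrow> 'a) set" and A :: "'a set"
  assumes fin: "finite A"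
    and arity_pos: "f \<in> F n \<Longrightarrow> 0 < n"
    and locality: "f \<in> F n \<Longrightarrow> (\<And>i. i < n \<Longrightarrow> a i = b i) \<Longrightarrow> f a = f b"
    and closed: "closed_under F A"
    and idem: "f \<in> F n \<Longrightarrow> x \<in> A \<Longrightarrow> f (\<lambda>_. x) = x"
    and ident: "(\<lambda>a. a 0) \<in> F 1"
    and minor: "f \<in> F n \<Longrightarrow> 0 < m \<Longrightarrow> (\<And>i. i < n \<Longrightarrow> \<pi> i < m) \<Longrightarrow> (\<lambda>a. f (\<lambda>i. a (\<pi> i))) \<in> F m"
    and star_in: "f \<in> F n \<Longrightarrow> g \<in> F m \<Longrightarrow> star m f g \<in> F (n * m)"
    and taylor: "\<exists>n. \<exists>t\<in>F n. taylor_op A n t"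
begin

lemma restrict:
  assumes "B \<subseteq> A" "closed_under F B"
  shows "taylor_clone F B"
proof
  show "finite B" using assms fin finite_subset by blast
  show "\<exists>n. \<exists>t\<in>F n. taylor_op B n t"
    using taylor taylor_op_mono[OF _ assms(1)] by blast
  show "f \<in> F n \<Longrightarrow> x \<in> B \<Longrightarrow> f (\<lambda>_. x) = x" for f n x
    using assms(1) idem by blast
  show "f \<in> F n \<Longrightarrow> 0 < n" for f n by (rule arity_pos)
  show "(\<lambda>a. a 0) \<in> F 1" by (rule ident)
  show "f \<in> F n \<Longrightarrow> g \<in> F m \<Longrightarrow> star m f g \<in> F (n * m)" for f g n m by (rule star_in)
  show "closed_under F B" by (rule assms(2))
  show "f a = f b" if "f \<in> F n" "\<And>i. i < n \<Longrightarrow> a i = b i" for f n a b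
    using that by (rule locality)
  show "(\<lambda>a. f (\<lambda>i. a (\<pi> i))) \<in> F m" if "f \<in> F n" "0 < m" "\<And>i. i < n \<Longrightarrow> \<pi> i < m" for f n m \<pi>
    using that by (rule minor)
qed

lemma idem': "f \<in> F n \<Longrightarrow> x \<in> A \<Longrightarrow> (\<And>i. i < n \<Longrightarrow> a i = x) \<Longrightarrow> f a = x"
  using locality[of f n a "\<lambda>_. x"] idem by auto

lemma closed_op: "f \<in> F n \<Longrightarrow> (\<And>i. i < n \<Longrightarrow> a i \<in> A) \<Longrightarrow> f a \<in> A"
  using closed by (rule closed_underD)

lemma absorbing_self: "absorbing F A A"
  unfolding absorbing_def
proof (intro conjI exI bexI)
  show "absorbs_by A 1 (\<lambda>a. a 0) A" by (simp add: absorbs_by_def)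
qed (use closed ident in auto)

text \<open>In \<open>star n g f\<close> the exceptional argument lies in a single block. The value
  of \<open>f\<close> on that block is in \<open>S\<close> by absorption and the values on all other
  blocks are in \<open>J\<close>, so \<open>g\<close> absorbs into \<open>J\<close>.\<close>

lemma absorbing_trans:
  assumes S: "absorbing F A S" and J: "absorbing F S J"
  shows "absorbing F A J"
proof -
  obtain n f where f: "f \<in> F n" "absorbs_by A n f S" and "S \<subseteq> A"
    using S by (auto simp: absorbing_def)
  obtain m g where g: "g \<in> F m" "absorbs_by S m g J" and JS: "J \<subseteq> S" "closed_under F J"
    using J by (auto simp: absorbing_def)
  have "absorbs_by A (m * n) (star n g f) J"
    unfolding absorbs_by_def
  proof (intro allI impI)
    fix k a
    assume k: "k < m * n" and aA: "\<forall>i<m * n. a i \<in> A" and aJ: "\<forall>i<m * n. i \<noteq> k \<longrightarrow> a i \<in> J"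
    have n: "0 < n" using f arity_pos by blast
    have km: "k div n < m" using k by (simp add: less_mult_imp_div_less)
    have ix: "i * n + j < m * n" if "i < m" "j < n" for i j
      using that by (metis mult_Suc add.commute less_le_trans mult_le_mono1 Suc_leI nat_add_left_cancel_less)
    have ixk: "i * n + j = k \<longleftrightarrow> i = k div n \<and> j = k mod n" if "j < n" for i j
      using that n by auto
    let ?c = "\<lambda>i. f (\<lambda>j. a (i * n + j))"
    have "?c i \<in> J" if "i < m" "i \<noteq> k div n" for i
      by (rule closed_underD[OF JS(2) f(1)]) (use that ix ixk aJ in auto)
    moreover have "?c (k div n) \<in> S"
    proof (rule absorbs_byD[OF f(2), of "k mod n"])
      fix j assume j: "j < n"
      then show "a (k div n * n + j) \<in> A" using ix[OF km] aA by blast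
      assume "j \<noteq> k mod n"
      then have "k div n * n + j \<noteq> k" using ixk[OF j, of "k div n"] by blast
      then show "a (k div n * n + j) \<in> S" using ix[OF km j] aJ JS(1) by blast
    qed (use n in simp)
    ultimately have "g ?c \<in> J"
      using JS(1) by (intro absorbs_byD[OF g(2) km]) (metis subsetD)+
    then show "star n g f a \<in> J" by (simp add: star_def)
  qed
  moreover have "star n g f \<in> F (m * n)" using f g star_in by blast
  ultimately show ?thesis using JS \<open>S \<subseteq> A\<close> by (auto simp: absorbing_def)
qed

lemma absorbing_subset:
  assumes "absorbing F A J" "J \<subseteq> S" "S \<subseteq> A"
  shows "absorbing F S J"
proof -
  obtain n f where "f \<in> F n" "absorbs_by A n f J" using assms by (auto simp: absorbing_def)
  moreover from this have "absorbs_by S n f J" using assms unfolding absorbs_by_def by blast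
  ultimately show ?thesis using assms unfolding absorbing_def by blast
qed

lemma minimal_absorbing_trans:
  assumes "absorbing F A S" "minimal_absorbing F S J"
  shows "minimal_absorbing F A J"
  unfolding minimal_absorbing_def
proof (intro conjI)
  show "J \<noteq> {}" using assms by (auto simp: minimal_absorbing_def)
  show "absorbing F A J" using assms absorbing_trans by (auto simp: minimal_absorbing_def)
  have "J \<subseteq> S" "S \<subseteq> A" using assms by (auto simp: minimal_absorbing_def absorbing_def)
  then have "absorbing F S J'" if "J' \<subset> J" "absorbing F A J'" for J'
    using that absorbing_subset[of J' S] by blast
  then show "\<not> (\<exists>J'. J' \<noteq> {} \<and> J' \<subset> J \<and> absorbing F A J')"
    using assms by (auto simp: minimal_absorbing_def)
qed

section \<open>Images under compatible relations, and changing one coordinate at a time\<close>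

lemma compat_relpow: "compatible F R \<Longrightarrow> compatible F (R ^^ m)"
  by (rule compatible_relpow) (auto intro: locality)

lemma closed_Image:
  assumes "compatible F R" "closed_under F B"
  shows "closed_under F (R `` B)"
  unfolding closed_under_def
proof (intro allI ballI impI)
  fix n f a
  assume f: "f \<in> F n" and a: "\<forall>i<n. a i \<in> R `` B"
  then have "\<forall>i. \<exists>b. i < n \<longrightarrow> b \<in> B \<and> (b, a i) \<in> R" by blast
  then obtain b where b: "\<And>i. i < n \<Longrightarrow> b i \<in> B \<and> (b i, a i) \<in> R" by metis
  then have "f b \<in> B" "(f b, f a) \<in> R"
    using f assms by (auto intro: closed_underD compatibleD)
  then show "f a \<in> R `` B" by blast
qed

text \<open>The arguments are lifted along \<open>R\<close>: all but the \<open>k\<close>-th into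
  \<open>B\<close>, the \<open>k\<close>-th to any predecessor. The operation absorbs the lifts, and
  compatibility brings the value back.\<close>

lemma absorbs_by_Image:
  assumes "compatible F R" "f \<in> F n" "absorbs_by A n f B" "R \<subseteq> A \<times> A"
    and pred: "\<And>x. x \<in> A \<Longrightarrow> \<exists>y. (y, x) \<in> R"
  shows "absorbs_by A n f (R `` B)"
  unfolding absorbs_by_def
proof (intro allI impI)
  fix k a
  assume k: "k < n" and aA: "\<forall>i<n. a i \<in> A" and aB: "\<forall>i<n. i \<noteq> k \<longrightarrow> a i \<in> R `` B"
  have "\<forall>i. \<exists>b. i < n \<longrightarrow> (b, a i) \<in> R \<and> (i \<noteq> k \<longrightarrow> b \<in> B)"
    using aA aB pred by (metis Image_iff)
  then obtain b where b: "\<And>i. i < n \<Longrightarrow> (b i, a i) \<in> R \<and> (i \<noteq> k \<longrightarrow> b i \<in> B)" by metis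
  then have "f b \<in> B" using assms(3,4) k unfolding absorbs_by_def by blast
  moreover have "(f b, f a) \<in> R" using b assms(1,2) by (auto intro: compatibleD)
  ultimately show "f a \<in> R `` B" by blast
qed

lemma absorbs_by_Int:
  "absorbs_by A n f B \<Longrightarrow> absorbs_by A n f C \<Longrightarrow> absorbs_by A n f (B \<inter> C)"
  by (auto simp: absorbs_by_def)

text \<open>By idempotence \<open>a\<close> and \<open>b\<close> are the values of \<open>f\<close>
  at constant tuples, and one constant tuple is turned into the other one coordinate at a
  time.\<close>

lemma coordinatewise:
  assumes f: "f \<in> F n" and "trans \<Theta>" "refl \<Theta>" and ab: "a \<in> A" "b \<in> A"
    and step: "\<And>k x. k < n \<Longrightarrow> (\<And>i. i < n \<Longrightarrow> x i \<in> {a, b}) \<Longrightarrow> (f (x(k := a)), f (x(k := b))) \<in> \<Theta>"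
  shows "(a, b) \<in> \<Theta>"
proof -
  let ?z = "\<lambda>j i. if i < j then b else a"
  have "(f (?z 0), f (?z j)) \<in> \<Theta>" if "j \<le> n" for j
    using that
  proof (induction j)
    case 0
    then show ?case using assms(3) by (auto simp: refl_on_def)
  next
    case (Suc j)
    have "(?z j)(j := a) = ?z j" "(?z j)(j := b) = ?z (Suc j)" by (auto simp: fun_eq_iff)
    then have "(f (?z j), f (?z (Suc j))) \<in> \<Theta>" using step[of j "?z j"] Suc.prems by simp
    then show ?case using Suc assms(2) by (meson Suc_leD transD)
  qed
  from this[of n] have "(f (?z 0), f (?z n)) \<in> \<Theta>" by simp
  moreover have "f (?z 0) = a" "f (?z n) = b" using f ab idem' by auto
  ultimately show ?thesis by simp
qed

end

section \<open>Transitive operations and linked relations\<close>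

definition reach :: "'a set \<Rightarrow> nat \<Rightarrow> ((nat \<Rightarrow> 'a) \<Rightarrow> 'a) \<Rightarrow> nat \<Rightarrow> 'a rel" where
  "reach A n f w = {(b, c). \<exists>a. (\<forall>i<n. a i \<in> A) \<and> a w = b \<and> f a = c}"

lemma transitive_op_reach:
  "transitive_op A n s \<longleftrightarrow> (\<forall>w<n. A \<times> A \<subseteq> reach A n s w)"
  by (auto simp: transitive_op_def reach_def)

definition absorption_free :: "(nat \<Rightarrow> ((nat \<Rightarrow> 'a) \<Rightarrow> 'a) set) \<Rightarrow> 'a set \<Rightarrow> bool" where
  "absorption_free F A \<longleftrightarrow> (\<forall>B. B \<noteq> {} \<longrightarrow> absorbing F A B \<longrightarrow> B = A)"

lemma absorption_freeD: "absorption_free F A \<Longrightarrow> absorbing F A B \<Longrightarrow> x \<in> B \<Longrightarrow> B = A"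
  by (auto simp: absorption_free_def)

context taylor_clone
begin

lemma reach_refl: "f \<in> F n \<Longrightarrow> b \<in> A \<Longrightarrow> (b, b) \<in> reach A n f w"
  using idem by (auto simp: reach_def intro!: exI[of _ "\<lambda>_. b"])

lemma reach_subset: "f \<in> F n \<Longrightarrow> w < n \<Longrightarrow> reach A n f w \<subseteq> A \<times> A"
  using closed_op by (auto simp: reach_def)

text \<open>Block \<open>w div m\<close> receives a tuple witnessing the first step; every other
  block is constant, so idempotence makes \<open>g\<close> return the entry that \<open>f\<close>
  needs there.\<close>

lemma reach_star:
  assumes f: "f \<in> F n" and g: "g \<in> F m" and w: "w < n * m"
  shows "reach A m g (w mod m) O reach A n f (w div m) \<subseteq> reach A (n * m) (star m f g) w"
proof clarify
  fix b c d
  assume "(b, c) \<in> reach A m g (w mod m)" "(c, d) \<in> reach A n f (w div m)"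
  then obtain a1 a2 where a1: "\<forall>i<m. a1 i \<in> A" "a1 (w mod m) = b" "g a1 = c"
    and a2: "\<forall>i<n. a2 i \<in> A" "a2 (w div m) = c" "f a2 = d"
    by (auto simp: reach_def)
  have m: "0 < m" using g arity_pos by blast
  define a where "a l = (if l div m = w div m then a1 (l mod m) else a2 (l div m))" for l
  have blk: "g (\<lambda>j. a (i * m + j)) = a2 i" if "i < n" for i
  proof (cases "i = w div m")
    case True
    have "g (\<lambda>j. a (i * m + j)) = g a1"
      by (rule locality[OF g]) (simp add: a_def True)
    then show ?thesis using a1 a2 True by simp
  next
    case False
    then show ?thesis using a2 that by (intro idem'[OF g]) (auto simp: a_def)
  qed
  have "star m f g a = f a2"
    unfolding star_def by (rule locality[OF f]) (simp add: blk)
  moreover have "\<forall>l<n * m. a l \<in> A"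
    using a1 a2 m by (auto simp: a_def less_mult_imp_div_less)
  moreover have "a w = b" using a1 by (simp add: a_def)
  ultimately show "(b, d) \<in> reach A (n * m) (star m f g) w"
    using a2 by (auto simp: reach_def)
qed

lemma reach_star_left:
  assumes "f \<in> F n" "g \<in> F m" "w < n * m"
  shows "reach A n f (w div m) \<subseteq> reach A (n * m) (star m f g) w"
proof
  fix x assume x: "x \<in> reach A n f (w div m)"
  have "w div m < n" using assms by (simp add: less_mult_imp_div_less)
  then have "fst x \<in> A" using x reach_subset[OF assms(1)] by force
  then have "(fst x, fst x) \<in> reach A m g (w mod m)" by (rule reach_refl[OF assms(2)])
  then show "x \<in> reach A (n * m) (star m f g) w"
    using x reach_star[OF assms] by (cases x) auto
qed

lemma reach_star_right:
  assumes "f \<in> F n" "g \<in> F m" "w < n * m"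
  shows "reach A m g (w mod m) \<subseteq> reach A (n * m) (star m f g) w"
proof
  fix x assume x: "x \<in> reach A m g (w mod m)"
  have "w mod m < m" using assms arity_pos by auto
  then have "snd x \<in> A" using x reach_subset[OF assms(2)] by force
  then have "(snd x, snd x) \<in> reach A n f (w div m)" by (rule reach_refl[OF assms(1)])
  then show "x \<in> reach A (n * m) (star m f g) w"
    using x reach_star[OF assms] by (cases x) auto
qed

text \<open>Star composition only enlarges \<open>reach\<close>, so an operation meeting a monotone
  requirement can be composed in without spoiling those already met.\<close>

lemma star_collect:
  assumes mono: "\<And>x R S. R \<subseteq> S \<Longrightarrow> Q x R \<Longrightarrow> Q x S"
    and "finite X" and "\<And>x. x \<in> X \<Longrightarrow> \<exists>n. \<exists>f\<in>F n. \<forall>w<n. Q x (reach A n f w)"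
  shows "\<exists>n. \<exists>f\<in>F n. \<forall>w<n. \<forall>x\<in>X. Q x (reach A n f w)"
  using assms(2,3)
proof (induction X rule: finite_induct)
  case empty
  then show ?case using ident by blast
next
  case (insert x X)
  then obtain n f where f: "f \<in> F n" "\<And>w y. w < n \<Longrightarrow> y \<in> X \<Longrightarrow> Q y (reach A n f w)" by blast
  obtain m g where g: "g \<in> F m" "\<And>w. w < m \<Longrightarrow> Q x (reach A m g w)" using insert by blast
  have m: "0 < m" using g arity_pos by blast
  have "Q y (reach A (n * m) (star m f g) w)" if w: "w < n * m" and y: "y \<in> insert x X" for w y
  proof (cases "y = x")
    case True
    have "Q x (reach A m g (w mod m))" using g m by simp
    then show ?thesis using mono[OF reach_star_right[OF f(1) g(1) w]] True by blast
  next
    case False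
    have "Q y (reach A n f (w div m))" using f w y False by (simp add: less_mult_imp_div_less)
    then show ?thesis using mono[OF reach_star_left[OF f(1) g(1) w]] by blast
  qed
  then show ?case using star_in[OF f(1) g(1)] by blast
qed

text \<open>With respect to \<open>D\<close> every operation has a deciding coordinate. A Taylor
  identity at the deciding coordinate \<open>w\<close> of \<open>t\<close> has x there on one side
  and y on the other, so the binary minor of \<open>t\<close> lands in \<open>D\<close> as soon as
  one of its two arguments does.\<close>

lemma projective_subset_absorbs:
  assumes D: "D \<subseteq> A" and proj: "\<And>n f. f \<in> F n \<Longrightarrow> \<exists>w<n. reach A n f w `` D \<subseteq> D"
  shows "absorbing F A D"
  unfolding absorbing_def
proof (intro conjI)
  show "closed_under F D"
    unfolding closed_under_def
  proof (intro allI ballI impI)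
    fix n f a
    assume f: "f \<in> F n" and a: "\<forall>i<n. a i \<in> D"
    then obtain w where "w < n" "reach A n f w `` D \<subseteq> D" using proj by blast
    moreover have "(a w, f a) \<in> reach A n f w" using a D by (auto simp: reach_def)
    ultimately show "f a \<in> D" using a by blast
  qed
  obtain n t where t: "t \<in> F n" "taylor_op A n t" using taylor by blast
  obtain w where w: "w < n" "reach A n t w `` D \<subseteq> D" using proj t by blast
  obtain p q :: "nat \<Rightarrow> nat" where p: "\<And>i. i < n \<Longrightarrow> p i < 2" "p w = 0"
    and q: "\<And>i. i < n \<Longrightarrow> q i < 2" "q w = 1"
    and pq: "\<And>a. a 0 \<in> A \<Longrightarrow> a 1 \<in> A \<Longrightarrow> t (\<lambda>i. a (p i)) = t (\<lambda>i. a (q i))"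
    using t(2) w(1) by (rule taylor_opE) blast
  have in_D: "t (\<lambda>i. a (r i)) \<in> D"
    if "a 0 \<in> A" "a 1 \<in> A" "a (r w) \<in> D" "\<And>i. i < n \<Longrightarrow> r i < 2" for a and r :: "nat \<Rightarrow> nat"
  proof -
    have "a (r i) \<in> A" if "i < n" for i
      using \<open>a 0 \<in> A\<close> \<open>a 1 \<in> A\<close> \<open>\<And>i. i < n \<Longrightarrow> r i < 2\<close>[OF that] by (auto simp: less_2_cases_iff)
    then have "(a (r w), t (\<lambda>i. a (r i))) \<in> reach A n t w"
      unfolding reach_def by (auto intro!: exI[of _ "\<lambda>i. a (r i)"])
    then show ?thesis using that w by blast
  qed
  let ?g = "\<lambda>a. t (\<lambda>i. a (p i))"
  have "absorbs_by A 2 ?g D"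
    unfolding absorbs_by_def
  proof (intro allI impI)
    fix k :: nat and a :: "nat \<Rightarrow> 'a"
    assume k: "k < 2" and a: "\<forall>i<2. a i \<in> A" "\<forall>i<2. i \<noteq> k \<longrightarrow> a i \<in> D"
    show "?g a \<in> D"
    proof (cases "k = 0")
      case True
      \<comment> \<open>Here the argument known to be in \<open>D\<close> is \<open>a 1\<close>,
        which stands at coordinate \<open>w\<close> on the \<open>q\<close> side of the
        identity.\<close>
      then have "t (\<lambda>i. a (q i)) \<in> D" using a q by (intro in_D) auto
      then show ?thesis using pq a by simp
    next
      case False
      then show ?thesis using a p k by (intro in_D) auto
    qed
  qed
  moreover have "?g \<in> F 2" using minor[OF t(1), of 2 p] p by simp
  ultimately show "\<exists>n. \<exists>f\<in>F n. absorbs_by A n f D" by blast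
qed (rule D)

text \<open>A proper nonempty \<open>D\<close> not left by any operation at all coordinates
  simultaneously would be absorbing by \<open>projective_subset_absorbs\<close>. So one operation
  \<open>h\<close> leaves every such \<open>D\<close> at every coordinate, and iterating it enlarges
  all reach sets up to \<open>A\<close>.\<close>

lemma transitive_op_exists:
  assumes "absorption_free F A"
  shows "\<exists>n. \<exists>s\<in>F n. transitive_op A n s"
proof -
  let ?X = "{D. D \<noteq> {} \<and> D \<subset> A}"
  have "\<exists>n. \<exists>f\<in>F n. \<forall>w<n. \<forall>D\<in>?X. \<not> reach A n f w `` D \<subseteq> D"
  proof (rule star_collect[where Q = "\<lambda>D R. \<not> R `` D \<subseteq> D"])
    show "finite ?X" using fin by (rule rev_finite_subset[OF finite_Pow_iff[THEN iffD2]]) auto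
    show "\<not> S `` D \<subseteq> D" if "R \<subseteq> S" "\<not> R `` D \<subseteq> D" for R S :: "'a rel" and D
      using that by blast
    fix D assume D: "D \<in> ?X"
    show "\<exists>n. \<exists>f\<in>F n. \<forall>w<n. \<not> reach A n f w `` D \<subseteq> D"
    proof (rule ccontr)
      assume "\<not> ?thesis"
      then have "absorbing F A D" by (intro projective_subset_absorbs) (use D in blast)+
      then show False using assms D unfolding absorption_free_def by blast
    qed
  qed
  then obtain n h where h: "h \<in> F n"
    "\<forall>w<n. \<forall>D\<in>?X. \<not> reach A n h w `` D \<subseteq> D" by blast
  \<comment> \<open>Putting \<open>h\<close> outside \<open>f\<close> adds at least one element to
    each reach set that is not yet \<open>A\<close>.\<close>
  have "\<exists>m. \<exists>f\<in>F m. \<forall>w<m. \<forall>b\<in>A. min j (card A) \<le> card (reach A m f w `` {b})" for j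
  proof (induction j)
    case 0
    then show ?case using ident by auto
  next
    case (Suc j)
    then obtain m f where f: "f \<in> F m"
      "\<And>w b. w < m \<Longrightarrow> b \<in> A \<Longrightarrow> min j (card A) \<le> card (reach A m f w `` {b})" by blast
    have m: "0 < m" using f arity_pos by blast
    have "min (Suc j) (card A) \<le> card (reach A (n * m) (star m h f) w `` {b})"
      if w: "w < n * m" and b: "b \<in> A" for w b
    proof -
      let ?D = "reach A m f (w mod m) `` {b}" and ?S = "reach A n h (w div m)"
      let ?T = "reach A (n * m) (star m h f) w `` {b}"
      have wd: "w mod m < m" "w div m < n" using m w by (auto simp: less_mult_imp_div_less)
      have "b \<in> ?D" using reach_refl[OF f(1) b] by blast
      have DA: "?D \<subseteq> A" using reach_subset[OF f(1) wd(1)] by blast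
      have TA: "?T \<subseteq> A" using reach_subset[OF star_in[OF h(1) f(1)] w] by blast
      have ST: "?S `` ?D \<subseteq> ?T" using reach_star[OF h(1) f(1) w] by blast
      have DS: "?D \<subseteq> ?S `` ?D" using reach_refl[OF h(1)] DA by blast
      have finT: "finite ?T" using TA fin finite_subset by blast
      show ?thesis
      proof (cases "?D = A")
        case True
        then have "?T = A" using ST DS TA by blast
        then show ?thesis by simp
      next
        case False
        then have "?D \<in> ?X" using \<open>b \<in> ?D\<close> DA by blast
        then have "\<not> ?S `` ?D \<subseteq> ?D" using h(2) wd(2) by blast
        then have "?D \<subset> ?T" using ST DS by blast
        then have "card ?D < card ?T" using finT psubset_card_mono by blast
        then show ?thesis using f(2)[OF wd(1) b] by linarith
      qed
    qed
    then show ?case using star_in[OF h(1) f(1)] by blast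
  qed
  then obtain m f where f: "f \<in> F m"
    "\<And>w b. w < m \<Longrightarrow> b \<in> A \<Longrightarrow> min (card A) (card A) \<le> card (reach A m f w `` {b})" by blast
  have "reach A m f w `` {b} = A" if "w < m" "b \<in> A" for w b
    using reach_subset[OF f(1) that(1)] f(2)[OF that] fin by (intro card_seteq) auto
  then show ?thesis unfolding transitive_op_reach using f by blast
qed

lemma transitive_opE:
  assumes "transitive_op A n s" "w < n" "b \<in> A" "c \<in> A"
  obtains a where "\<And>i. i < n \<Longrightarrow> a i \<in> A" "a w = b" "s a = c"
proof -
  obtain a where "(\<forall>i<n. a i \<in> A) \<and> a w = b \<and> s a = c"
    using assms unfolding transitive_op_def by blast
  then show thesis by (intro that[of a]) auto
qed

text \<open>The centre \<open>?C\<close>, the elements related to all of \<open>A\<close>, is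
  absorbed by a transitive \<open>s\<close>: the exceptional argument has some neighbour
  \<open>b\<close>, and \<open>s\<close> attains every \<open>y\<close> with \<open>b\<close> at
  that coordinate. Without proper absorption the centre is all of \<open>A\<close> once it contains
  \<open>c\<close>.\<close>

lemma center_full:
  assumes free: "absorption_free F A" and R: "R \<subseteq> A \<times> A" "compatible F R"
    and tot: "\<And>x. x \<in> A \<Longrightarrow> \<exists>y. (x, y) \<in> R"
    and c: "c \<in> A" "\<And>y. y \<in> A \<Longrightarrow> (c, y) \<in> R"
  shows "R = A \<times> A"
proof -
  let ?C = "{x \<in> A. \<forall>y\<in>A. (x, y) \<in> R}"
  obtain n s where s: "s \<in> F n" "transitive_op A n s" using transitive_op_exists[OF free] by blast
  have "closed_under F ?C"
    unfolding closed_under_def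
  proof (intro allI ballI impI)
    fix m f a
    assume f: "f \<in> F m" and a: "\<forall>i<m. a i \<in> ?C"
    have "(f a, y) \<in> R" if "y \<in> A" for y
    proof -
      have "(f a, f (\<lambda>_. y)) \<in> R" using a that by (intro compatibleD[OF R(2) f]) auto
      then show ?thesis using idem[OF f that] by simp
    qed
    then show "f a \<in> ?C" using a closed_op[OF f] by auto
  qed
  moreover have "absorbs_by A n s ?C"
    unfolding absorbs_by_def
  proof (intro allI impI)
    fix k a
    assume k: "k < n" and aA: "\<forall>i<n. a i \<in> A" and aC: "\<forall>i<n. i \<noteq> k \<longrightarrow> a i \<in> ?C"
    obtain b where b: "(a k, b) \<in> R" "b \<in> A" using tot aA k R(1) by blast
    have "(s a, y) \<in> R" if y: "y \<in> A" for y
    proof -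
      obtain e where e: "\<And>i. i < n \<Longrightarrow> e i \<in> A" "e k = b" "s e = y"
        using s(2) k b(2) y by (rule transitive_opE) blast
      have "(s a, s e) \<in> R"
        using aC e b by (intro compatibleD[OF R(2) s(1)]) (case_tac "i = k", auto)
      then show ?thesis using e by simp
    qed
    then show "s a \<in> ?C" using closed_op[OF s(1)] aA by auto
  qed
  ultimately have "absorbing F A ?C" using s(1) unfolding absorbing_def by blast
  moreover have "c \<in> ?C" using c by simp
  ultimately have "?C = A" by (rule absorption_freeD[OF free])
  then show ?thesis using R(1) by blast
qed

text \<open>From common neighbours of pairs one passes to common neighbours of larger sets, using
  \<open>center_full\<close> in each step. A common neighbour of all of \<open>A\<close> lies in the
  centre of \<open>R\<inverse>\<close>, and \<open>center_full\<close> applies once more.\<close>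

lemma common_neighbours_full:
  assumes free: "absorption_free F A" and R: "R \<subseteq> A \<times> A" "compatible F R"
    and onto: "\<And>y. y \<in> A \<Longrightarrow> \<exists>x. (x, y) \<in> R"
    and pairs: "A \<times> A \<subseteq> link R"
  shows "R = A \<times> A"
proof -
  have common: "\<forall>a\<in>A. \<exists>c. (a, c) \<in> R \<and> (\<forall>y\<in>Y. (y, c) \<in> R)"
    if "finite Y" "Y \<noteq> {}" "Y \<subseteq> A" for Y
    using that
  proof (induction Y rule: finite_ne_induct)
    case (singleton y)
    then show ?case using pairs by (fastforce simp: link_def)
  next
    case (insert z Y)
    let ?Q = "{(a, c) \<in> R. \<forall>y\<in>Y. (y, c) \<in> R}"
    have Q: "\<exists>c. (a, c) \<in> ?Q" if "a \<in> A" for a using insert that by simp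
    have "compatible F ?Q"
      unfolding compatible_def
    proof (intro allI ballI impI)
      fix n f a b
      assume f: "f \<in> F n" and ab: "\<forall>i<n. (a i, b i) \<in> ?Q"
      have "(y, f b) \<in> R" if "y \<in> Y" for y
      proof -
        have "(f (\<lambda>_. y), f b) \<in> R" using ab that by (intro compatibleD[OF R(2) f]) auto
        then show ?thesis using idem[OF f, of y] that insert.prems by auto
      qed
      moreover have "(f a, f b) \<in> R" using ab by (intro compatibleD[OF R(2) f]) auto
      ultimately show "(f a, f b) \<in> ?Q" by auto
    qed
    then have "compatible F (link ?Q)" by (rule compatible_link)
    moreover obtain y where y: "y \<in> Y" using insert by blast
    \<comment> \<open>A \<open>?Q\<close>-neighbour of \<open>a\<close> is by definition adjacent to
      all of \<open>Y\<close>, hence is also a \<open>?Q\<close>-neighbour of \<open>y\<close>. So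
      \<open>y\<close> is central in \<open>link ?Q\<close>.\<close>
    have "(y, a) \<in> link ?Q" if "a \<in> A" for a
      using Q[OF that] y by (fastforce simp: link_def)
    moreover have "link ?Q \<subseteq> A \<times> A" using R(1) by (auto simp: link_def)
    moreover have "\<exists>b. (a, b) \<in> link ?Q" if "a \<in> A" for a
      using Q[OF that] by (fastforce simp: link_def)
    ultimately have "link ?Q = A \<times> A"
      using insert.prems y by (intro center_full[OF free, of _ y]) auto
    then have "(a, z) \<in> link ?Q" if "a \<in> A" for a using insert.prems that by auto
    then show ?case by (fastforce simp: link_def)
  qed
  show ?thesis
  proof (cases "A = {}")
    case True
    then show ?thesis using R by blast
  next
    case False
    then obtain c where c: "\<forall>y\<in>A. (y, c) \<in> R" using common[of A] fin by blast
    have "R\<inverse> = A \<times> A"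
    proof (rule center_full[OF free])
      show "compatible F (R\<inverse>)" using R by (simp add: compatible_converse)
      show "c \<in> A" using c R False by blast
    qed (use R onto c in auto)
    then show ?thesis by auto
  qed
qed

text \<open>Some power of \<open>link R\<close> with exponent \<open>2 ^ j\<close> is full. For
  symmetric \<open>S\<close> the relation \<open>S O S\<close> is \<open>link S\<close>, so
  \<open>common_neighbours_full\<close> halves the exponent until \<open>link R\<close> itself is
  full; a last application gives \<open>R\<close>.\<close>

lemma linked_full:
  assumes free: "absorption_free F A" and R: "smooth_on A R" "compatible F R"
    and linked: "A \<times> A \<subseteq> (link R)\<^sup>*"
  shows "R = A \<times> A"
proof -
  let ?T = "link R"
  have RA: "R \<subseteq> A \<times> A" using R by (simp add: smooth_on_def)
  have TA: "?T \<subseteq> A \<times> A" using RA by (auto simp: link_def)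
  have refl: "(x, x) \<in> ?T" if "x \<in> A" for x using R(1) that by (auto simp: link_def smooth_on_def)
  obtain k where k: "A \<times> A \<subseteq> ?T ^^ k"
    using rtrancl_uniform[OF TA refl _ _ linked] fin by auto
  have halve: "A \<times> A \<subseteq> S" if S: "S \<subseteq> A \<times> A" "sym S" "compatible F S" "\<And>x. x \<in> A \<Longrightarrow> (x, x) \<in> S"
    and "A \<times> A \<subseteq> S O S" for S
  proof -
    have "S\<inverse> = S" using S(2) by (simp add: sym_conv_converse_eq)
    then have "link S = S O S" by (simp add: link_def)
    then have "S = A \<times> A" using that by (intro common_neighbours_full[OF free]) auto
    then show ?thesis by simp
  qed
  have "A \<times> A \<subseteq> ?T ^^ (2 ^ j) \<Longrightarrow> A \<times> A \<subseteq> ?T" for j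
  proof (induction j)
    case (Suc j)
    let ?S = "?T ^^ (2 ^ j)"
    have "A \<times> A \<subseteq> ?S"
    proof (rule halve)
      show "?S \<subseteq> A \<times> A" using relpow_pos_subset[OF TA] by simp
      show "sym ?S" using sym_link[of R] relpow_converse[where E = "?T" and n = "2 ^ j"]
        by (simp add: sym_conv_converse_eq)
      show "compatible F ?S" using R compatible_link compat_relpow by blast
      show "(x, x) \<in> ?S" if "x \<in> A" for x
        using relpow_refl_mono[OF TA refl that, of x 0] by simp
      show "A \<times> A \<subseteq> ?S O ?S" using Suc.prems by (simp add: relpow_add mult_2)
    qed
    then show ?case by (rule Suc.IH)
  qed simp
  moreover have "A \<times> A \<subseteq> ?T ^^ (2 ^ k)"
    using k relpow_refl_mono[OF TA refl, of _ _ k "2 ^ k"] by (auto simp: less_imp_le)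
  ultimately have "A \<times> A \<subseteq> link R" by blast
  then show ?thesis
    using R RA by (intro common_neighbours_full[OF free]) (auto simp: smooth_on_def)
qed

text \<open>
  For a fixed coordinate \<open>k\<close> of \<open>s\<close>, transitivity lets one reach any parameter while prescribing
  the parameter used at \<open>k\<close>. So if \<open>a, b\<close> are related at some parameter, then exchanging
  \<open>a\<close> for \<open>b\<close> in one argument of \<open>s\<close> gives elements connected at every parameter.
\<close>

lemma connected_at_every_parameter:
  fixes U :: "(nat \<Rightarrow> 'a) \<Rightarrow> 'a rel"
  assumes s: "s \<in> F n" "transitive_op A n s" and P: "P \<subseteq> A"
    and U: "\<And>e. range e \<subseteq> A \<Longrightarrow> U e \<subseteq> P \<times> P"
      "\<And>e x. range e \<subseteq> A \<Longrightarrow> x \<in> P \<Longrightarrow> (x, x) \<in> U e"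
      "\<And>e a b. (\<And>i. i < n \<Longrightarrow> range (e i) \<subseteq> A) \<Longrightarrow> (\<And>i. i < n \<Longrightarrow> (a i, b i) \<in> U (e i)) \<Longrightarrow>
        (s a, s b) \<in> U (\<lambda>j. s (\<lambda>i. e i j))"
    and connected: "P \<times> P \<subseteq> (\<Union>e\<in>{e. range e \<subseteq> A}. U e)\<^sup>*"
    and e: "range e \<subseteq> A"
  shows "P \<times> P \<subseteq> (U e)\<^sup>*"
proof clarify
  fix a b
  assume ab: "a \<in> P" "b \<in> P"
  have *: "(s (x(k := a)), s (x(k := b))) \<in> (U e)\<^sup>*"
    if k: "k < n" and x: "\<And>i. i < n \<Longrightarrow> x i \<in> P"
      and e0: "range e0 \<subseteq> A" and ab: "(a, b) \<in> U e0" for k x a b e0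
  proof -
    \<comment> \<open>For every index \<open>j\<close> of the parameter sequence, transitivity of
      \<open>s\<close> supplies parameters for all coordinates, with the prescribed
      \<open>e0 j\<close> at coordinate \<open>k\<close> and the target \<open>e j\<close> as
      value.\<close>
    have "\<forall>j. \<exists>c. (\<forall>i<n. c i \<in> A) \<and> c k = e0 j \<and> s c = e j"
      using s(2) k e0 e unfolding transitive_op_def by blast
    then obtain c where c: "\<And>j i. i < n \<Longrightarrow> c j i \<in> A" "\<And>j. c j k = e0 j" "\<And>j. s (c j) = e j"
      by metis
    have rng: "range (\<lambda>j. c j i) \<subseteq> A" if "i < n" for i using c that by blast
    have "(s (x(k := a)), s (x(k := b))) \<in> U (\<lambda>j. s (\<lambda>i. c j i))"
      using k x ab c(2) U(2)[OF rng] by (intro U(3) rng) auto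
    then show ?thesis using c(3) by simp
  qed
  have step: "(s (x(k := a)), s (x(k := b))) \<in> (U e)\<^sup>*"
    if k: "k < n" and x: "\<And>i. i < n \<Longrightarrow> x i \<in> P" for k x
  proof -
    have "(a, b) \<in> (\<Union>e\<in>{e. range e \<subseteq> A}. U e)\<^sup>*" using ab connected by blast
    then show ?thesis
    proof (induction rule: rtrancl_induct)
      case (step y z)
      then obtain e0 where "range e0 \<subseteq> A" "(y, z) \<in> U e0" by blast
      then show ?case using *[OF k x] step.IH by (meson rtrancl_trans)
    qed simp
  qed
  show "(a, b) \<in> (U e)\<^sup>*"
    by (rule coordinatewise[OF s(1)]) (use ab P in \<open>auto simp: trans_rtrancl refl_rtrancl intro!: step\<close>)
qed

section \<open>Descending along an absorbing subuniverse\<close>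

lemma closed_walk_ends:
  assumes "compatible F E" "closed_under F K"
  shows "closed_under F (((E \<inter> K \<times> K) ^^ m) `` K)"
  by (rule closed_Image[OF compat_relpow[OF compatible_Int_Times[OF assms]] assms(2)])

lemma trim_absorbing:
  assumes E: "smooth_on A E" "compatible F E" and f: "f \<in> F n"
    and K: "K \<subseteq> A" "K \<noteq> {}" "closed_under F K" "absorbs_by A n f K"
    and out: "\<And>x. x \<in> K \<Longrightarrow> \<exists>y\<in>K. (x, y) \<in> E"
  shows "\<exists>S\<subseteq>K. S \<noteq> {} \<and> closed_under F S \<and> absorbs_by A n f S \<and> smooth_on S (E \<inter> S \<times> S)"
proof -
  let ?V = "\<lambda>m. ((E \<inter> K \<times> K) ^^ m) `` K"
  have VK: "?V m \<subseteq> K" for m by (cases m) auto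
  have "absorbs_by A n f (?V m)" for m
  proof (induction m)
    case 0
    then show ?case using K by simp
  next
    case (Suc m)
    have "?V (Suc m) = K \<inter> E `` ?V m" using VK[of m] by auto
    moreover have "absorbs_by A n f (E `` ?V m)"
      by (rule absorbs_by_Image[OF E(2) f Suc]) (use E(1) in \<open>auto simp: smooth_on_def\<close>)
    ultimately show ?case using absorbs_by_Int[OF K(4)] by simp
  qed
  moreover have "finite K" using K(1) fin finite_subset by blast
  from trim_out_smooth[OF this K(2) out] obtain M where
    "\<forall>m\<ge>M. ?V m = ?V M \<and> ?V M \<noteq> {} \<and> ?V M \<subseteq> K \<and> smooth_on (?V M) (E \<inter> ?V M \<times> ?V M) \<and>
    (\<forall>x\<in>?V M. \<forall>y\<in>K. (x, y) \<in> E \<longrightarrow> y \<in> ?V M)" by blast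
  then have "?V M \<noteq> {}" "?V M \<subseteq> K" "smooth_on (?V M) (E \<inter> ?V M \<times> ?V M)" by blast+
  ultimately show ?thesis using closed_walk_ends[OF E(2) K(3)] by (intro exI[of _ "?V M"]) blast
qed

lemma link_rtrancl_compat:
  assumes R: "smooth_on A R" "compatible F R" and f: "f \<in> F n"
    and ab: "\<And>i. i < n \<Longrightarrow> a i \<in> A" "\<And>i. i < n \<Longrightarrow> (a i, b i) \<in> (link R)\<^sup>*"
  shows "(f a, f b) \<in> (link R)\<^sup>*"
proof (rule rtrancl_family[where n = n and f = f and a = a and b = b and R = "\<lambda>_. link R" and
      X = "\<lambda>_. A"])
  show "(f a, f b) \<in> link R" if "\<And>i. i < n \<Longrightarrow> (a i, b i) \<in> link R" for a b
    using that by (rule compatibleD[OF compatible_link[OF R(2)] f])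
  show "f a = f b" if "\<And>i. i < n \<Longrightarrow> a i = b i" for a b using that by (rule locality[OF f])
  show "link R \<subseteq> A \<times> A" "\<And>x. x \<in> A \<Longrightarrow> (x, x) \<in> link R"
    using R(1) by (auto simp: link_def smooth_on_def)
qed (use ab in auto)

text \<open>One argument \<open>a\<close> of \<open>f\<close> is changed to \<open>b\<close> along a
  fence of the whole digraph, while the other arguments move inside \<open>S\<close>. The operation
  absorbs every vertex obtained on the way into \<open>S\<close>, and \<open>coordinatewise\<close>
  joins these fences into one from \<open>a\<close> to \<open>b\<close>.\<close>

lemma absorbing_inherits_link:
  assumes E: "smooth_on A E" "compatible F E" and f: "f \<in> F n"
    and S: "S \<subseteq> A" "absorbs_by A n f S" "smooth_on S (E \<inter> S \<times> S)"
    and m: "0 < m" and linked: "A \<times> A \<subseteq> (link (E ^^ m))\<^sup>*"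
  shows "S \<times> S \<subseteq> (link ((E \<inter> S \<times> S) ^^ m))\<^sup>*"
proof clarify
  let ?ES = "E \<inter> S \<times> S"
  let ?T = "link (?ES ^^ m)"
  fix a b
  assume ab: "a \<in> S" "b \<in> S"
  have edge: "(f x, f y) \<in> ?ES"
    if k: "k < n" and xy: "\<And>i. i < n \<Longrightarrow> (x i, y i) \<in> (if i = k then E else ?ES)" for k x y
  proof -
    have xy': "(x i, y i) \<in> E" "i \<noteq> k \<Longrightarrow> (x i, y i) \<in> S \<times> S" if "i < n" for i
      using xy[OF that] by (auto split: if_splits)
    have EA: "E \<subseteq> A \<times> A" using E by (simp add: smooth_on_def)
    have "f x \<in> S" "f y \<in> S"
      using xy' EA by (auto intro!: absorbs_byD[OF S(2) k])
    moreover have "(f x, f y) \<in> E" using xy' by (intro compatibleD[OF E(2) f])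
    ultimately show ?thesis by blast
  qed
  have fence: "(f x, f y) \<in> ?T"
    if k: "k < n" and xy: "\<And>i. i < n \<Longrightarrow> (x i, y i) \<in> link ((if i = k then E else ?ES) ^^ m)"
    for k x y
  proof -
    let ?R = "\<lambda>i. if i = k then E else ?ES"
    have "\<forall>i. \<exists>c. i < n \<longrightarrow> (x i, c) \<in> ?R i ^^ m \<and> (y i, c) \<in> ?R i ^^ m"
      using xy unfolding link_def by blast
    then obtain c where c: "\<And>i. i < n \<Longrightarrow> (x i, c i) \<in> ?R i ^^ m \<and> (y i, c i) \<in> ?R i ^^ m"
      by metis
    have "(f z, f c) \<in> ?ES ^^ m" if "\<And>i. i < n \<Longrightarrow> (z i, c i) \<in> ?R i ^^ m" for z
      by (rule relpow_family[where n = n and R = ?R])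
        (use that edge[OF k] locality[OF f] in blast)+
    then have "(f x, f c) \<in> ?ES ^^ m" "(f y, f c) \<in> ?ES ^^ m" using c by blast+
    then show ?thesis by (auto simp: link_def)
  qed
  have step: "(f (x(k := a)), f (x(k := b))) \<in> ?T\<^sup>*"
    if k: "k < n" and x: "\<And>i. i < n \<Longrightarrow> x i \<in> {a, b}" for k x
  proof (rule rtrancl_family[where n = n and f = f and a = "x(k := a)" and b = "x(k := b)" and
        X = "\<lambda>i. if i = k then A else S" and R = "\<lambda>i. link ((if i = k then E else ?ES) ^^ m)"])
    show "(f x, f y) \<in> ?T" if "\<And>i. i < n \<Longrightarrow> (x i, y i) \<in> link ((if i = k then E else ?ES) ^^ m)"
      for x y using fence[OF k that] by blast
    show "f x = f y" if "\<And>i. i < n \<Longrightarrow> x i = y i" for x y using that by (rule locality[OF f])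
    show "((x(k := a)) i, (x(k := b)) i) \<in> (link ((if i = k then E else ?ES) ^^ m))\<^sup>*" if "i < n" for i
      using linked ab S(1) by auto
    show "(x(k := a)) i \<in> (if i = k then A else S)" if "i < n" for i
      using x[OF that] ab S(1) by auto
    fix i assume "i < n"
    show "link ((if i = k then E else ?ES) ^^ m) \<subseteq> (if i = k then A else S) \<times> (if i = k then A else S)"
      using relpow_pos_subset[of E A m] relpow_pos_subset[of ?ES S m] E(1) S(3) m
      by (auto simp: link_def smooth_on_def)
    show "(y, y) \<in> link ((if i = k then E else ?ES) ^^ m)" if "y \<in> (if i = k then A else S)" for y
      using that smooth_on_succ[OF E(1), of y m] smooth_on_succ[OF S(3), of y m]
      by (auto simp: link_def)
  qed
  show "(a, b) \<in> ?T\<^sup>*"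
    by (rule coordinatewise[OF f]) (use ab S(1) step in \<open>auto simp: trans_rtrancl refl_rtrancl\<close>)
qed

lemma smooth_on_Image: "smooth_on A E \<Longrightarrow> K \<noteq> {} \<Longrightarrow> K \<subseteq> A \<Longrightarrow> E `` K \<noteq> {} \<and> E `` K \<subseteq> A"
  unfolding smooth_on_def by blast

text \<open>Otherwise forward and backward images of proper absorbing sets would remain proper,
  hence so would all images of \<open>I\<close> under powers of \<open>link (E ^^ m)\<close>. One of
  these powers is full.\<close>

lemma expanding_absorbing_exists:
  assumes E: "smooth_on A E" "compatible F E" and m: "0 < m"
    and linked: "A \<times> A \<subseteq> (link (E ^^ m))\<^sup>*"
    and f: "f \<in> F n" and I: "I \<noteq> {}" "I \<subset> A" "closed_under F I" "absorbs_by A n f I"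
  shows "\<exists>K. K \<noteq> {} \<and> K \<subset> A \<and> closed_under F K \<and> absorbs_by A n f K \<and> (E `` K = A \<or> E\<inverse> `` K = A)"
proof (rule ccontr)
  assume contra: "\<not> ?thesis"
  let ?P = "\<lambda>K. K \<noteq> {} \<and> K \<subset> A \<and> closed_under F K \<and> absorbs_by A n f K"
  have EA: "E \<subseteq> A \<times> A" using E by (simp add: smooth_on_def)
  have step: "?P (D `` K)" if D: "D = E \<or> D = E\<inverse>" and K: "?P K" for D K
  proof -
    have D': "smooth_on A D" "compatible F D"
      using D E by (auto simp: smooth_on_converse compatible_converse)
    have "D `` K \<noteq> A" using contra K D by blast
    then show ?thesis
      using K smooth_on_Image[OF D'(1), of K] closed_Image[OF D'(2), of K]
        absorbs_by_Image[OF D'(2) f, of K] D'(1)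
      by (auto simp: smooth_on_def)
  qed
  have pow: "?P ((D ^^ j) `` K)" if "D = E \<or> D = E\<inverse>" "?P K" for D K j
  proof (induction j)
    case 0
    then show ?case using that by simp
  next
    case (Suc j)
    have "(D ^^ Suc j) `` K = D `` ((D ^^ j) `` K)" by auto
    then show ?case using step[OF that(1) Suc] by simp
  qed
  let ?T = "link (E ^^ m)"
  have "?T `` K = ((E\<inverse>) ^^ m) `` ((E ^^ m) `` K)" for K
    by (auto simp: link_def relpow_converse)
  then have link: "?P (?T `` K)" if "?P K" for K using pow that by simp
  have linkpow: "?P ((?T ^^ j) `` I)" for j
  proof (induction j)
    case 0
    then show ?case using I by simp
  next
    case (Suc j)
    have "(?T ^^ Suc j) `` I = ?T `` ((?T ^^ j) `` I)" by auto
    then show ?case using link[OF Suc] by simp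
  qed
  have TA: "?T \<subseteq> A \<times> A" using relpow_pos_subset[OF EA m] by (auto simp: link_def)
  have "(x, x) \<in> ?T" if "x \<in> A" for x
    using smooth_on_succ[OF E(1) that, of m] by (auto simp: link_def)
  then obtain j where "A \<times> A \<subseteq> ?T ^^ j" using rtrancl_uniform[OF TA _ _ _ linked] fin by auto
  then have "A \<subseteq> (?T ^^ j) `` I" using I by blast
  then show False using linkpow[of j] by blast
qed

lemma absorbing_descent:
  assumes E: "smooth_on A E" "compatible F E" and m: "0 < m"
    and linked: "A \<times> A \<subseteq> (link (E ^^ m))\<^sup>*" and "\<not> absorption_free F A"
  shows "\<exists>S. S \<noteq> {} \<and> S \<subset> A \<and> absorbing F A S \<and> smooth_on S (E \<inter> S \<times> S) \<and>
    S \<times> S \<subseteq> (link ((E \<inter> S \<times> S) ^^ m))\<^sup>*"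
proof -
  obtain I where "I \<noteq> {}" "absorbing F A I" "I \<noteq> A" using assms unfolding absorption_free_def by blast
  then obtain n f where f: "f \<in> F n" and I: "I \<noteq> {}" "I \<subset> A" "closed_under F I" "absorbs_by A n f I"
    unfolding absorbing_def by blast
  obtain K where K: "K \<noteq> {}" "K \<subset> A" "closed_under F K" "absorbs_by A n f K"
    and ex: "E `` K = A \<or> E\<inverse> `` K = A"
    using expanding_absorbing_exists[OF E m linked f I] by blast
  \<comment> \<open>The edges are oriented so that every vertex has a \<open>D\<close>-successor in
    \<open>K\<close>, as \<open>trim_absorbing\<close> requires. Smoothness of the trimmed set does
    not depend on the orientation.\<close>
  obtain D where D: "D = E \<or> D = E\<inverse>" "D\<inverse> `` K = A" using ex by force
  have D': "smooth_on A D" "compatible F D"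
    using D E by (auto simp: smooth_on_converse compatible_converse)
  have "\<exists>y\<in>K. (x, y) \<in> D" if "x \<in> K" for x using that K(2) D(2) by blast
  then obtain S where S: "S \<subseteq> K" "S \<noteq> {}" "closed_under F S" "absorbs_by A n f S"
    "smooth_on S (D \<inter> S \<times> S)"
    using trim_absorbing[OF D' f _ K(1,3,4)] K(2) by blast
  have "E\<inverse> \<inter> S \<times> S = (E \<inter> S \<times> S)\<inverse>" by auto
  then have sm: "smooth_on S (E \<inter> S \<times> S)" using S(5) D(1) smooth_on_converse by metis
  have SA: "S \<subset> A" using S K by blast
  have "absorbing F A S" unfolding absorbing_def using S f SA by blast
  then show ?thesis
    using S SA sm absorbing_inherits_link[OF E f _ S(4) sm m linked] by blast
qed

end

section \<open>The absorption-free case\<close>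

text \<open>Fences made of two \<open>D\<close>-walks with a common end. With
  \<open>\<theta>\<close> an equivalence, \<open>e i\<close> represents the block that both walks
  visit at step \<open>i + 1\<close>; the starts carry no label, being confined to
  \<open>P\<close>.\<close>

definition labelled_link :: "'a rel \<Rightarrow> 'a rel \<Rightarrow> 'a set \<Rightarrow> nat \<Rightarrow> (nat \<Rightarrow> 'a) \<Rightarrow> 'a rel" where
  "labelled_link D \<theta> P L e = {(a, b) \<in> P \<times> P. \<exists>p q. p 0 = a \<and> q 0 = b \<and> p L = q L \<and>
     (\<forall>i<L. (p i, p (Suc i)) \<in> D \<and> (q i, q (Suc i)) \<in> D \<and>
       (e i, p (Suc i)) \<in> \<theta> \<and> (e i, q (Suc i)) \<in> \<theta>)}"

text \<open>The labels are read off the first walk; \<open>d\<close> only fills the sequence beyond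
  \<open>L\<close>, keeping its range in \<open>A\<close>.\<close>

lemma labelled_linkI:
  assumes "a \<in> P" "b \<in> P" "p 0 = a" "q 0 = b" "p L = q L"
    and "\<And>i. i < L \<Longrightarrow> (p i, p (Suc i)) \<in> D" "\<And>i. i < L \<Longrightarrow> (q i, q (Suc i)) \<in> D"
    and "\<And>i. i < L \<Longrightarrow> (p (Suc i), q (Suc i)) \<in> \<theta>" and "refl \<theta>" "D \<subseteq> A \<times> A" "d \<in> A"
  shows "\<exists>e. range e \<subseteq> A \<and> (a, b) \<in> labelled_link D \<theta> P L e"
proof (intro exI conjI)
  let ?e = "\<lambda>i. if i < L then p (Suc i) else d"
  show "range ?e \<subseteq> A" using assms(6,10,11) by fastforce
  show "(a, b) \<in> labelled_link D \<theta> P L ?e"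
    unfolding labelled_link_def mem_Collect_eq case_prod_conv
    by (intro conjI exI[of _ p] exI[of _ q]) (use assms in \<open>auto simp: refl_on_def\<close>)
qed

context taylor_clone
begin

text \<open>The label sequence is the parameter of \<open>connected_at_every_parameter\<close>.
  Reflexivity holds because \<open>out\<close> continues a walk into any prescribed block, and
  operations act on walks and labels in parallel. A constant label keeps both walks of a fence in
  one block after the start.\<close>

lemma link_at_every_label:
  assumes s: "s \<in> F n" "transitive_op A n s" and P: "P \<subseteq> A" "closed_under F P"
    and D: "compatible F D" "D \<subseteq> A \<times> A"
    and \<theta>: "\<And>m f a b. f \<in> F m \<Longrightarrow> (\<And>i. i < m \<Longrightarrow> a i \<in> A) \<Longrightarrow> (\<And>i. i < m \<Longrightarrow> (a i, b i) \<in> \<theta>) \<Longrightarrow>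
      (f a, f b) \<in> \<theta>"
    and out: "\<And>a b. a \<in> A \<Longrightarrow> b \<in> A \<Longrightarrow> \<exists>a'. (a, a') \<in> D \<and> (b, a') \<in> \<theta>"
    and connected: "P \<times> P \<subseteq> (\<Union>e\<in>{e. range e \<subseteq> A}. labelled_link D \<theta> P L e)\<^sup>*"
    and d: "d \<in> A"
  shows "P \<times> P \<subseteq> (labelled_link D \<theta> P L (\<lambda>_. d))\<^sup>*"
proof (rule connected_at_every_parameter[OF s P(1) _ _ _ connected])
  show "labelled_link D \<theta> P L e \<subseteq> P \<times> P" for e by (auto simp: labelled_link_def)
  show "range (\<lambda>_. d) \<subseteq> A" using d by auto
next
  fix e :: "nat \<Rightarrow> 'a" and x
  assume e: "range e \<subseteq> A" and x: "x \<in> P"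
  have "\<exists>p. p 0 = x \<and> (\<forall>i. p i \<in> A \<and> (p i, p (Suc i)) \<in> D \<and> (e i, p (Suc i)) \<in> \<theta>)"
  proof (rule walk_choice)
    show "\<exists>y\<in>A. (z, y) \<in> D \<and> (e i, y) \<in> \<theta>" if "z \<in> A" for i z
      using out[OF that, of "e i"] e D(2) by blast
  qed (use x P in blast)
  then show "(x, x) \<in> labelled_link D \<theta> P L e" using x unfolding labelled_link_def by blast
next
  fix e :: "nat \<Rightarrow> nat \<Rightarrow> 'a" and a b
  assume e: "\<And>i. i < n \<Longrightarrow> range (e i) \<subseteq> A"
    and ab: "\<And>i. i < n \<Longrightarrow> (a i, b i) \<in> labelled_link D \<theta> P L (e i)"
  let ?W = "\<lambda>i p q. p 0 = a i \<and> q 0 = b i \<and> p L = q L \<and>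
     (\<forall>j<L. (p j, p (Suc j)) \<in> D \<and> (q j, q (Suc j)) \<in> D \<and>
       (e i j, p (Suc j)) \<in> \<theta> \<and> (e i j, q (Suc j)) \<in> \<theta>)"
  have "\<exists>p q. ?W i p q" if "i < n" for i
    using ab[OF that, unfolded labelled_link_def] by simp
  then obtain p q where pq: "\<And>i. i < n \<Longrightarrow> ?W i (p i) (q i)" by metis
  have abP: "a i \<in> P" "b i \<in> P" if "i < n" for i
    using ab[OF that] by (auto simp: labelled_link_def)
  have eA: "e i j \<in> A" if "i < n" for i j using e[OF that] by blast
  let ?p = "\<lambda>j. s (\<lambda>i. p i j)" and ?q = "\<lambda>j. s (\<lambda>i. q i j)"
  have "?p 0 = s a" "?q 0 = s b" "?p L = ?q L"
    using pq by (auto intro!: locality[OF s(1)])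
  moreover have "(?p j, ?p (Suc j)) \<in> D" "(?q j, ?q (Suc j)) \<in> D" if "j < L" for j
    using pq that by (auto intro!: compatibleD[OF D(1) s(1)])
  moreover have "(s (\<lambda>i. e i j), ?p (Suc j)) \<in> \<theta>" "(s (\<lambda>i. e i j), ?q (Suc j)) \<in> \<theta>"
    if "j < L" for j
    using pq that eA by (auto intro!: \<theta>[OF s(1)])
  moreover have "s a \<in> P" "s b \<in> P"
    using abP by (auto intro!: closed_underD[OF P(2) s(1)])
  ultimately show "(s a, s b) \<in> labelled_link D \<theta> P L (\<lambda>j. s (\<lambda>i. e i j))"
    unfolding labelled_link_def mem_Collect_eq case_prod_conv
    by (intro conjI exI[of _ ?p] exI[of _ ?q]) auto
qed

end

context taylor_clone
begin

lemma smooth_on_relpow: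
  assumes "smooth_on A E" "0 < m"
  shows "smooth_on A (E ^^ m)"
  unfolding smooth_on_def
proof (intro conjI ballI)
  show "E ^^ m \<subseteq> A \<times> A" using relpow_pos_subset assms by (auto simp: smooth_on_def)
  show "\<exists>y. (x, y) \<in> E ^^ m" if "x \<in> A" for x using smooth_on_succ[OF assms(1) that] by blast
  show "\<exists>y. (y, x) \<in> E ^^ m" if "x \<in> A" for x using smooth_on_pred[OF assms(1) that] by blast
qed

text \<open>
  \<open>S\<close> is the set of vertices on bi-infinite walks inside one block \<open>B\<close> of left linkedness \<open>\<theta>\<close> of
  \<open>E ^^ k\<close>; equivalently, inside the block \<open>C\<close> of right linkedness \<open>\<rho>\<close> corresponding to \<open>B\<close>. Walks can
  be continued forwards into prescribed \<open>\<theta>\<close>-blocks and backwards into prescribed \<open>\<rho>\<close>-blocks. Two walks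
  with a common end visit the same \<open>\<theta>\<close>-blocks, as their \<open>i\<close>-th vertices have a common \<open>k\<close>-th successor;
  dually for a common start and \<open>\<rho>\<close>. So the lemma \<open>link_at_every_label\<close> applies with the sequence of
  visited blocks as parameter, first to \<open>\<theta>\<close> (confining walks to \<open>B\<close>), then to \<open>\<rho>\<close> (confining them
  to \<open>S\<close>).
\<close>

lemma absorption_free_descent:
  assumes E: "smooth_on A E" "compatible F E" and free: "absorption_free F A"
    and k: "0 < k" "E ^^ Suc k = A \<times> A" "E ^^ k \<noteq> A \<times> A"
  shows "\<exists>S M. S \<noteq> {} \<and> S \<subset> A \<and> closed_under F S \<and> smooth_on S (E \<inter> S \<times> S) \<and> 0 < M \<and>
    S \<times> S \<subseteq> (link ((E \<inter> S \<times> S) ^^ M))\<^sup>*"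
proof -
  obtain n s where s: "s \<in> F n" "transitive_op A n s" using transitive_op_exists[OF free] by blast
  have EA: "E \<subseteq> A \<times> A" using E by (simp add: smooth_on_def)
  have Es: "\<exists>y. (x, y) \<in> E" if "x \<in> A" for x using E(1) that by (auto simp: smooth_on_def)
  have Ek: "smooth_on A (E ^^ k)" "compatible F (E ^^ k)"
    using smooth_on_relpow[OF E(1) k(1)] compat_relpow[OF E(2)] by auto
  define \<theta> where "\<theta> = (link (E ^^ k))\<^sup>*"
  define \<rho> where "\<rho> = (link ((E ^^ k)\<inverse>))\<^sup>*"
  have \<theta>_sym: "(y, x) \<in> \<theta>" if "(x, y) \<in> \<theta>" for x y
    using that unfolding \<theta>_def by (rule sym_link_rtrancl)
  have \<rho>_sym: "(y, x) \<in> \<rho>" if "(x, y) \<in> \<rho>" for x y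
    using that unfolding \<rho>_def by (rule sym_link_rtrancl)
  have \<theta>_A: "y \<in> A" if "(x, y) \<in> \<theta>" "x \<in> A" for x y
    using rtrancl_link_closed[OF EA, of x y k] that by (simp add: \<theta>_def)
  have \<rho>_A: "y \<in> A" if "(x, y) \<in> \<rho>" "x \<in> A" for x y
    using rtrancl_link_closed[of "E\<inverse>" A x y k] EA that by (auto simp: \<rho>_def relpow_converse)
  have \<theta>_compat: "(f a, f b) \<in> \<theta>"
    if "f \<in> F m" "\<And>i. i < m \<Longrightarrow> a i \<in> A" "\<And>i. i < m \<Longrightarrow> (a i, b i) \<in> \<theta>" for m f a b
    using link_rtrancl_compat[OF Ek] that unfolding \<theta>_def by blast
  have "smooth_on A ((E ^^ k)\<inverse>)" "compatible F ((E ^^ k)\<inverse>)"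
    using Ek by (simp_all add: smooth_on_converse compatible_converse)
  then have \<rho>_compat: "(f a, f b) \<in> \<rho>"
    if "f \<in> F m" "\<And>i. i < m \<Longrightarrow> a i \<in> A" "\<And>i. i < m \<Longrightarrow> (a i, b i) \<in> \<rho>" for m f a b
    using link_rtrancl_compat that unfolding \<rho>_def by blast
  have out: "\<exists>a'. (a, a') \<in> E \<and> (b, a') \<in> \<theta>" if ab: "a \<in> A" "b \<in> A" for a b
  proof -
    \<comment> \<open>A vertex \<open>c\<close> lying \<open>k\<close> steps after \<open>b\<close>
      is \<open>k + 1\<close> steps after \<open>a\<close>, as \<open>E ^^ Suc k\<close> is full;
      the first vertex on that walk from \<open>a\<close> shares the \<open>k\<close>-th successor
      \<open>c\<close> with \<open>b\<close>.\<close>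
    obtain c where c: "c \<in> A" "(b, c) \<in> E ^^ k" using smooth_on_succ[OF E(1) ab(2)] by blast
    then have "(a, c) \<in> E ^^ Suc k" using ab k by blast
    then obtain a' where "(a, a') \<in> E" "(a', c) \<in> E ^^ k" by (rule relpow_Suc_E2)
    then show ?thesis using c by (auto simp: \<theta>_def link_def)
  qed
  have inn: "\<exists>c'. (c', c) \<in> E \<and> (d, c') \<in> \<rho>" if cd: "c \<in> A" "d \<in> A" for c d
  proof -
    obtain u where u: "u \<in> A" "(u, d) \<in> E ^^ k" using smooth_on_pred[OF E(1) cd(2)] by blast
    then have "(u, c) \<in> E ^^ Suc k" using cd k by blast
    then obtain c' where "(u, c') \<in> E ^^ k" "(c', c) \<in> E" by auto
    then show ?thesis using u by (auto simp: \<rho>_def link_def)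
  qed
  \<comment> \<open>Walks of length \<open>k\<close> match the blocks of \<open>\<theta>\<close>
    with those of \<open>\<rho>\<close>; in particular they lead from \<open>B\<close> exactly into
    \<open>C\<close>.\<close>
  have \<theta>_\<rho>: "(x, y) \<in> \<theta> \<longleftrightarrow> (x', y') \<in> \<rho>" if "(x, x') \<in> E ^^ k" "(y, y') \<in> E ^^ k" for x y x' y'
    using link_rtrancl_transfer[of x' y' "E ^^ k" x y] link_rtrancl_transfer[of x y "(E ^^ k)\<inverse>" x' y']
      that unfolding \<theta>_def \<rho>_def by auto
  have "\<not> A \<times> A \<subseteq> \<theta>" using linked_full[OF free Ek] k(3) unfolding \<theta>_def by blast
  then obtain b0 x0 where b0: "b0 \<in> A" "x0 \<in> A" "(b0, x0) \<notin> \<theta>" by blast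
  obtain d0 where d0: "d0 \<in> A" "(b0, d0) \<in> E ^^ k" using smooth_on_succ[OF E(1) b0(1)] by blast
  define B where "B = {x. (b0, x) \<in> \<theta>}"
  define C where "C = {x. (d0, x) \<in> \<rho>}"
  have BA: "B \<subset> A" using \<theta>_A b0 by (auto simp: B_def)
  have CA: "C \<subseteq> A" using \<rho>_A d0 by (auto simp: C_def)
  have b0B: "b0 \<in> B" by (simp add: B_def \<theta>_def)
  have \<theta>_B: "(x, y) \<in> \<theta>" if "x \<in> B" "y \<in> B" for x y
    using that \<theta>_sym unfolding B_def \<theta>_def by (blast intro: rtrancl_trans)
  have \<rho>_C: "(x, y) \<in> \<rho>" if "x \<in> C" "y \<in> C" for x y
    using that \<rho>_sym unfolding C_def \<rho>_def by (blast intro: rtrancl_trans)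
  have B_\<theta>: "y \<in> B" if "x \<in> B" "(x, y) \<in> \<theta>" for x y
    using that unfolding B_def \<theta>_def by (blast intro: rtrancl_trans)
  have B_iff_C: "x \<in> B \<longleftrightarrow> x' \<in> C" if "(x, x') \<in> E ^^ k" for x x'
    using \<theta>_\<rho>[OF d0(2) that] by (simp add: B_def C_def)
  have B_closed: "closed_under F B"
    unfolding closed_under_def
  proof (intro allI ballI impI)
    fix m f a
    assume f: "f \<in> F m" and a: "\<forall>i<m. a i \<in> B"
    have "(f (\<lambda>_. b0), f a) \<in> \<theta>" using a b0 by (intro \<theta>_compat[OF f]) (auto simp: B_def)
    then show "f a \<in> B" using idem[OF f b0(1)] by (simp add: B_def)
  qed
  have B_out: "\<exists>y\<in>B. (x, y) \<in> E" if "x \<in> B" for x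
    using out[of x b0] that BA b0 by (auto simp: B_def)
  let ?EB = "E \<inter> B \<times> B"
  have "finite B" using BA fin finite_subset by blast
  from trim_out_smooth[OF this _ B_out] b0B obtain M0 where
    M0: "\<forall>m\<ge>M0. (?EB ^^ m) `` B = (?EB ^^ M0) `` B \<and> (?EB ^^ M0) `` B \<noteq> {} \<and>
      (?EB ^^ M0) `` B \<subseteq> B \<and>
      smooth_on ((?EB ^^ M0) `` B) (E \<inter> (?EB ^^ M0) `` B \<times> (?EB ^^ M0) `` B) \<and>
      (\<forall>x\<in>(?EB ^^ M0) `` B. \<forall>y\<in>B. (x, y) \<in> E \<longrightarrow> y \<in> (?EB ^^ M0) `` B)" by blast
  \<comment> \<open>\<open>M \<ge> M0\<close> makes the trimmed set stable. \<open>M \<ge> k\<close>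
    lets fences of length \<open>k\<close> be prolonged to length \<open>M\<close> and puts
    \<open>k\<close> steps inside \<open>B\<close> before each vertex of \<open>S\<close>.\<close>
  define M where "M = max k M0"
  define S where "S = (?EB ^^ M) `` B"
  have "S = (?EB ^^ M0) `` B" using M0 unfolding S_def M_def by (meson max.cobounded2)
  then have S: "S \<noteq> {}" "S \<subseteq> B" "smooth_on S (E \<inter> S \<times> S)"
    using M0 by (metis order_refl)+
  have Mk: "k \<le> M" "0 < M" using k by (auto simp: M_def)
  let ?ES = "E \<inter> S \<times> S"
  have S_closed: "closed_under F S"
    unfolding S_def by (rule closed_walk_ends[OF E(2) B_closed])
  have EBB: "?EB ^^ j \<subseteq> B \<times> B" if "0 < j" for j using relpow_pos_subset[of ?EB B j] that by blast
  have pow_mono: "X ^^ j \<subseteq> Y ^^ j" if "X \<subseteq> Y" for X Y :: "'a rel" and j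
    using that by (rule relpow_subset_mono)

  have linkB: "B \<times> B \<subseteq> (link (?EB ^^ M))\<^sup>*"
  proof -
    \<comment> \<open>The constant label \<open>b0\<close> confines the fences to the block
      \<open>B\<close>.\<close>
    have "B \<times> B \<subseteq> (labelled_link E \<theta> B k (\<lambda>_. b0))\<^sup>*"
    proof (rule link_at_every_label[OF s _ B_closed E(2) EA _ _ _ b0(1)])
      show "B \<subseteq> A" using BA by blast
      show "(f a, f b) \<in> \<theta>" if "f \<in> F m" "\<And>i. i < m \<Longrightarrow> a i \<in> A" "\<And>i. i < m \<Longrightarrow> (a i, b i) \<in> \<theta>"
        for m f a b using that by (rule \<theta>_compat)
      show "\<exists>a'. (a, a') \<in> E \<and> (b, a') \<in> \<theta>" if "a \<in> A" "b \<in> A" for a b using that by (rule out)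
      show "B \<times> B \<subseteq> (\<Union>e\<in>{e. range e \<subseteq> A}. labelled_link E \<theta> B k e)\<^sup>*" (is "_ \<subseteq> ?T\<^sup>*")
      proof clarify
        fix a b
        assume a: "a \<in> B" and b: "b \<in> B"
        have "(a, b) \<in> (link (E ^^ k))\<^sup>*" using \<theta>_B[OF a b] by (simp add: \<theta>_def)
        then have "(a, b) \<in> ?T\<^sup>* \<and> b \<in> B"
        proof (induction rule: rtrancl_induct)
          case base
          then show ?case using a by simp
        next
          case (step y z)
          then have y: "y \<in> B" by blast
          have z: "z \<in> B" using B_\<theta>[OF y] step(2) by (auto simp: \<theta>_def)
          obtain c where c: "(y, c) \<in> E ^^ k" "(z, c) \<in> E ^^ k" using step(2) by (auto simp: link_def)
          obtain p where p: "p 0 = y" "p k = c" "\<And>i. i < k \<Longrightarrow> (p i, p (Suc i)) \<in> E"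
            using c(1) by (auto simp: relpow_fun_conv)
          obtain q where q: "q 0 = z" "q k = c" "\<And>i. i < k \<Longrightarrow> (q i, q (Suc i)) \<in> E"
            using c(2) by (auto simp: relpow_fun_conv)
          have same: "(p (Suc i), q (Suc i)) \<in> \<theta>" if i: "i < k" for i
          proof -
            have "(p (Suc i), c) \<in> E ^^ (k - Suc i)" "(q (Suc i), c) \<in> E ^^ (k - Suc i)"
              using walk_relpow[of k p E "Suc i" k] walk_relpow[of k q E "Suc i" k] p q i
              by auto
            then have "(p (Suc i), q (Suc i)) \<in> link (E ^^ (k - Suc i))" by (auto simp: link_def)
            moreover have "p (Suc i) \<in> A" using p(3)[OF i] EA by blast
            ultimately have "(p (Suc i), q (Suc i)) \<in> link (E ^^ k)"
              using link_relpow_mono[OF EA Es, of "p (Suc i)" "q (Suc i)" "k - Suc i" k] by simp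
            then show ?thesis by (simp add: \<theta>_def)
          qed
          have "\<exists>e. range e \<subseteq> A \<and> (y, z) \<in> labelled_link E \<theta> B k e"
          proof (rule labelled_linkI[where p = p and q = q and d = b0])
            show "(p i, p (Suc i)) \<in> E" "(q i, q (Suc i)) \<in> E" "(p (Suc i), q (Suc i)) \<in> \<theta>"
              if "i < k" for i using that p(3) q(3) same by blast+
            show "p k = q k" using p q by simp
            show "refl \<theta>" by (simp add: \<theta>_def refl_rtrancl)
          qed (use EA b0 y z p q in auto)
          then have "(y, z) \<in> ?T" by blast
          then show ?case using step.IH z by (meson rtrancl.rtrancl_into_rtrancl)
        qed
        then show "(a, b) \<in> ?T\<^sup>*" by blast
      qed
    qed
    moreover have "labelled_link E \<theta> B k (\<lambda>_. b0) \<subseteq> link (?EB ^^ M)"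
    proof clarify
      fix a b
      assume "(a, b) \<in> labelled_link E \<theta> B k (\<lambda>_. b0)"
      then obtain p q where ab: "a \<in> B" "b \<in> B" and pq: "p 0 = a" "q 0 = b" "p k = q k"
        "\<And>i. i < k \<Longrightarrow> (p i, p (Suc i)) \<in> E \<and> (q i, q (Suc i)) \<in> E \<and> p (Suc i) \<in> B \<and> q (Suc i) \<in> B"
        unfolding labelled_link_def B_def by auto
      have walk: "(r 0, r k) \<in> ?EB ^^ k"
        if r: "r 0 \<in> B" "\<And>i. i < k \<Longrightarrow> (r i, r (Suc i)) \<in> E \<and> r (Suc i) \<in> B" for r
      proof -
        have "r i \<in> B" if "i \<le> k" for i using that r by (cases i) auto
        then show ?thesis using walk_relpow[of k r ?EB 0 k] r by auto
      qed
      have "(a, p k) \<in> ?EB ^^ k" "(b, p k) \<in> ?EB ^^ k"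
        using walk[of p] walk[of q] pq ab by auto
      then have "(a, b) \<in> link (?EB ^^ k)" unfolding link_def by blast
      then show "(a, b) \<in> link (?EB ^^ M)"
        by (rule link_relpow_mono[rotated 3, where A = B]) (use B_out ab Mk in auto)
    qed
    ultimately show ?thesis using rtrancl_mono by blast
  qed

  have SC: "S \<subseteq> C"
  proof
    fix x assume "x \<in> S"
    then obtain a where "a \<in> B" "(a, x) \<in> ?EB ^^ ((M - k) + k)" using Mk by (auto simp: S_def)
    then obtain y where "(y, x) \<in> ?EB ^^ k" unfolding relpow_add by blast
    then show "x \<in> C" using EBB[OF k(1)] pow_mono[of ?EB E k] B_iff_C by blast
  qed
  let ?EC = "E \<inter> C \<times> C"
  \<comment> \<open>\<open>W\<close> collects the vertices from which \<open>S\<close> is reached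
    inside \<open>C\<close>. Once \<open>W \<subseteq> S\<close> is known, backward walks from
    \<open>S\<close> that stay in \<open>C\<close> cannot leave \<open>S\<close>.\<close>
  define W where "W = {x. \<exists>j. \<exists>y\<in>S. (x, y) \<in> ?EC ^^ j}"
  have W_I: "x \<in> W" if "(x, y) \<in> ?EC ^^ j" "y \<in> S" for x y j using that by (auto simp: W_def)
  have WC: "W \<subseteq> C"
  proof
    fix x assume "x \<in> W"
    then obtain j y where "y \<in> S" "(x, y) \<in> ?EC ^^ j" by (auto simp: W_def)
    then show "x \<in> C" using SC relpow_pos_subset[of ?EC C j] by (cases j) auto
  qed
  have WB: "W \<subseteq> B"
  proof
    fix x assume "x \<in> W"
    then obtain j y where y: "y \<in> S" "(x, y) \<in> ?EC ^^ j" by (auto simp: W_def)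
    \<comment> \<open>Continuing the walk by \<open>k\<close> steps inside \<open>S\<close> ensures
      that its first \<open>k\<close> steps from \<open>x\<close> stay in \<open>C\<close>; then
      \<open>x\<close> belongs to \<open>B\<close> by the matching of blocks.\<close>
    obtain z where "(y, z) \<in> ?ES ^^ k" using smooth_on_succ[OF S(3) y(1)] by blast
    then have "(y, z) \<in> ?EC ^^ k" using pow_mono[of ?ES ?EC k] SC by blast
    then have "(x, z) \<in> ?EC ^^ (k + j)" using y by (auto simp: relpow_add add.commute[of k])
    then obtain u where "(x, u) \<in> ?EC ^^ k" unfolding relpow_add by blast
    then show "x \<in> B" using relpow_pos_subset[of ?EC C k] k(1) pow_mono[of ?EC E k] B_iff_C by blast
  qed
  have W_in: "\<exists>y. (y, x) \<in> E \<inter> W \<times> W" if x: "x \<in> W" for x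
  proof -
    have xC: "x \<in> C" using WC x by blast
    then obtain y where y: "(y, x) \<in> E" "y \<in> C" using inn[of x d0] CA d0 by (auto simp: C_def)
    obtain j z where "z \<in> S" "(x, z) \<in> ?EC ^^ j" using x by (auto simp: W_def)
    moreover have "(y, x) \<in> ?EC" using y xC by blast
    ultimately have "(y, z) \<in> ?EC ^^ Suc j" by (blast intro: relpow_Suc_I2)
    then have "y \<in> W" using \<open>z \<in> S\<close> by (rule W_I)
    then show ?thesis using y x by blast
  qed
  have WS: "W \<subseteq> S"
  proof
    fix x assume x: "x \<in> W"
    \<comment> \<open>Predecessors can be chosen in \<open>W\<close> repeatedly, so \<open>x\<close>
      ends a walk of length \<open>M\<close> inside \<open>B\<close>.\<close>
    obtain y where y: "y \<in> W" "(x, y) \<in> ((E \<inter> W \<times> W)\<inverse>) ^^ M"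
      using relpow_succ_ex[of "(E \<inter> W \<times> W)\<inverse>" W x M] W_in x by blast
    then have "(y, x) \<in> (E \<inter> W \<times> W) ^^ M" by (simp add: relpow_converse)
    then have "(y, x) \<in> ?EB ^^ M" using pow_mono[of "E \<inter> W \<times> W" ?EB M] WB by blast
    then show "x \<in> S" using y WB unfolding S_def by blast
  qed

  have linkS: "S \<times> S \<subseteq> (labelled_link (E\<inverse>) \<rho> S M (\<lambda>_. d0))\<^sup>*"
  proof (rule link_at_every_label[OF s _ S_closed compatible_converse[OF E(2)] _ _ _ _ d0(1)])
    show "S \<subseteq> A" using S BA by blast
    show "(f a, f b) \<in> \<rho>" if "f \<in> F m" "\<And>i. i < m \<Longrightarrow> a i \<in> A" "\<And>i. i < m \<Longrightarrow> (a i, b i) \<in> \<rho>"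
      for m f a b using that by (rule \<rho>_compat)
    show "E\<inverse> \<subseteq> A \<times> A" using EA by blast
    show "\<exists>a'. (a, a') \<in> E\<inverse> \<and> (b, a') \<in> \<rho>" if "a \<in> A" "b \<in> A" for a b using inn[OF that] by simp
    show "S \<times> S \<subseteq> (\<Union>e\<in>{e. range e \<subseteq> A}. labelled_link (E\<inverse>) \<rho> S M e)\<^sup>*" (is "_ \<subseteq> ?T\<^sup>*")
    proof clarify
      fix a b
      assume a: "a \<in> S" and b: "b \<in> S"
      then obtain a0 b1 where ab: "a0 \<in> B" "(a0, a) \<in> ?EB ^^ M" "b1 \<in> B" "(b1, b) \<in> ?EB ^^ M"
        by (auto simp: S_def)
      \<comment> \<open>Left linkedness of the starts in \<open>B\<close> becomes right linkedness
        of the ends in \<open>S\<close>, ready for the application to reversed edges.\<close>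
      then have "(a, b) \<in> (link ((?EB ^^ M)\<inverse>))\<^sup>*"
        using link_rtrancl_transfer[of a0 b1 "(?EB ^^ M)\<inverse>" a b] linkB by auto
      then show "(a, b) \<in> ?T\<^sup>*"
      proof (induction rule: rtrancl_induct)
        case (step y z)
        then obtain u where u: "(u, y) \<in> ?EB ^^ M" "(u, z) \<in> ?EB ^^ M" by (auto simp: link_def)
        have uB: "u \<in> B" using u(1) EBB[OF Mk(2)] by blast
        then have yz: "y \<in> S" "z \<in> S" using u by (auto simp: S_def)
        obtain P where P: "P 0 = u" "P M = y" "\<And>i. i < M \<Longrightarrow> (P i, P (Suc i)) \<in> ?EB"
          using u(1) unfolding relpow_fun_conv by blast
        obtain Q where Q: "Q 0 = u" "Q M = z" "\<And>i. i < M \<Longrightarrow> (Q i, Q (Suc i)) \<in> ?EB"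
          using u(2) unfolding relpow_fun_conv by blast
        \<comment> \<open>After at least \<open>k\<close> steps in \<open>B\<close> both vertices
          are in \<open>C\<close>. Earlier, the common start \<open>u\<close> is extended backwards
          by \<open>k - i\<close> steps to give a common \<open>k\<close>-th predecessor.\<close>
        have same: "(P i, Q i) \<in> \<rho>" if i: "i \<le> M" for i
        proof (cases "k \<le> i")
          case True
          have "X i \<in> C" if "\<And>i. i < M \<Longrightarrow> (X i, X (Suc i)) \<in> ?EB" for X
          proof -
            have "(X (i - k), X i) \<in> ?EB ^^ k"
              using walk_relpow[of M X ?EB "i - k" i, OF that] True i by simp
            then show ?thesis using EBB[OF k(1)] pow_mono[of ?EB E k] B_iff_C by blast
          qed
          then show ?thesis using P(3) Q(3) by (intro \<rho>_C) auto
        next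
          case False
          obtain v where v: "(v, u) \<in> E ^^ (k - i)" using smooth_on_pred[OF E(1), of u] uB BA by blast
          have "(v, X i) \<in> E ^^ k" if "\<And>i. i < M \<Longrightarrow> (X i, X (Suc i)) \<in> ?EB" "X 0 = u" for X
          proof -
            have "(u, X i) \<in> ?EB ^^ i" using walk_relpow[of M X ?EB 0 i, OF that(1)] i that(2) by simp
            then have "(u, X i) \<in> E ^^ i" using pow_mono[of ?EB E i] by blast
            then have "(v, X i) \<in> E ^^ ((k - i) + i)" using v unfolding relpow_add by blast
            then show ?thesis using False by simp
          qed
          then have "(v, P i) \<in> E ^^ k" "(v, Q i) \<in> E ^^ k" using P Q by blast+
          then show ?thesis by (auto simp: \<rho>_def link_def)
        qed
        have rev: "(X (M - i), X (M - Suc i)) \<in> E\<inverse>"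
          if "\<And>i. i < M \<Longrightarrow> (X i, X (Suc i)) \<in> ?EB" "i < M" for X i
          using that(1)[of "M - Suc i"] that(2) by (simp add: Suc_diff_Suc)
        have "\<exists>e. range e \<subseteq> A \<and> (y, z) \<in> labelled_link (E\<inverse>) \<rho> S M e"
        proof (rule labelled_linkI[where p = "\<lambda>i. P (M - i)" and q = "\<lambda>i. Q (M - i)" and d = d0])
          show "P (M - 0) = y" "Q (M - 0) = z" "P (M - M) = Q (M - M)" using P Q by auto
          show "(P (M - i), P (M - Suc i)) \<in> E\<inverse>" "(Q (M - i), Q (M - Suc i)) \<in> E\<inverse>" if "i < M" for i
            using rev[of P i] rev[of Q i] P(3) Q(3) that by blast+
          show "(P (M - Suc i), Q (M - Suc i)) \<in> \<rho>" if "i < M" for i by (rule same) simp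
          show "E\<inverse> \<subseteq> A \<times> A" using EA by blast
        qed (use d0 yz in \<open>auto simp: \<rho>_def refl_rtrancl\<close>)
        then have "(y, z) \<in> ?T" by blast
        then show ?case using step.IH by (meson rtrancl.rtrancl_into_rtrancl)
      qed simp
    qed
  qed
  \<comment> \<open>The constant label \<open>d0\<close> keeps the backward walks in
    \<open>C\<close>, and therefore in \<open>S\<close> because
    \<open>W \<subseteq> S\<close>.\<close>
  have "labelled_link (E\<inverse>) \<rho> S M (\<lambda>_. d0) \<subseteq> link ((?ES ^^ M)\<inverse>)"
  proof clarify
    fix a b
    assume "(a, b) \<in> labelled_link (E\<inverse>) \<rho> S M (\<lambda>_. d0)"
    then obtain p q where ab: "a \<in> S" "b \<in> S" and pq: "p 0 = a" "q 0 = b" "p M = q M"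
      "\<And>i. i < M \<Longrightarrow> (p (Suc i), p i) \<in> E \<and> (q (Suc i), q i) \<in> E \<and> p (Suc i) \<in> C \<and> q (Suc i) \<in> C"
      unfolding labelled_link_def C_def by auto
    have walk: "(r 0, r M) \<in> (?ES\<inverse>) ^^ M"
      if r: "r 0 \<in> S" "\<And>i. i < M \<Longrightarrow> (r (Suc i), r i) \<in> E \<and> r (Suc i) \<in> C" for r
    proof -
      have rC: "r i \<in> C" if "i \<le> M" for i using r SC that by (cases i) auto
      have "r i \<in> S" if i: "i \<le> M" for i
      proof -
        have "(r 0, r i) \<in> (?EC\<inverse>) ^^ i"
          using walk_relpow[of M r "?EC\<inverse>" 0 i] r rC i by auto
        then have "(r i, r 0) \<in> ?EC ^^ i" by (simp add: relpow_converse)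
        then show ?thesis using W_I r(1) WS by blast
      qed
      then show ?thesis using walk_relpow[of M r "?ES\<inverse>" 0 M] r by auto
    qed
    have "(a, p M) \<in> (?ES\<inverse>) ^^ M" "(b, q M) \<in> (?ES\<inverse>) ^^ M"
      using walk[of p] walk[of q] ab pq by auto
    then show "(a, b) \<in> link ((?ES ^^ M)\<inverse>)"
      unfolding link_def pq(3) relpow_converse by blast
  qed
  then have right: "S \<times> S \<subseteq> (link ((?ES ^^ M)\<inverse>))\<^sup>*"
    by (rule order_trans[OF linkS rtrancl_mono])
  have "S \<times> S \<subseteq> (link (?ES ^^ M))\<^sup>*"
  proof clarify
    fix a b assume ab: "a \<in> S" "b \<in> S"
    obtain a' where a': "a' \<in> S" "(a, a') \<in> ?ES ^^ M"
      using smooth_on_succ[OF S(3) ab(1)] by blast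
    obtain b' where b': "b' \<in> S" "(b, b') \<in> ?ES ^^ M"
      using smooth_on_succ[OF S(3) ab(2)] by blast
    have "(a', b') \<in> (link ((?ES ^^ M)\<inverse>))\<^sup>*" using right a' b' by blast
    then show "(a, b) \<in> (link (?ES ^^ M))\<^sup>*" using a'(2) b'(2) by (rule link_rtrancl_transfer)
  qed
  then show ?thesis using S BA S_closed Mk(2) by blast
qed

end

text \<open>A linked power is assumed instead of algebraic length one, since both kinds of descent
  preserve it. Descent to an absorbing \<open>S\<close> keeps \<open>J\<close> minimal absorbing. In
  the absorption-free case \<open>A\<close> itself is minimal absorbing, so the smaller subuniverse
  has to supply only the loop.\<close>

theorem loop_in_minimal_absorbing:
  assumes "taylor_clone F A" "A \<noteq> {}" "smooth_on A E" "compatible F E" "0 < m"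
    and "A \<times> A \<subseteq> (link (E ^^ m))\<^sup>*"
  shows "\<exists>J. minimal_absorbing F A J \<and> (\<exists>a\<in>J. (a, a) \<in> E)"
  using assms
proof (induction "card A" arbitrary: A E m rule: less_induct)
  case less
  interpret taylor_clone F A by fact
  note E = less.prems(3,4)
  have IH: "\<exists>J. minimal_absorbing F S J \<and> (\<exists>a\<in>J. (a, a) \<in> E)"
    if S: "S \<noteq> {}" "S \<subset> A" "closed_under F S" "smooth_on S (E \<inter> S \<times> S)" "0 < M"
      "S \<times> S \<subseteq> (link ((E \<inter> S \<times> S) ^^ M))\<^sup>*" for S M
    using less.hyps[OF psubset_card_mono[OF fin S(2)] restrict[OF _ S(3)] S(1,4) _ S(5,6)]
      compatible_Int_Times[OF E(2) S(3)] S(2) by blast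
  show ?case
  proof (cases "absorption_free F A")
    case False
    then obtain S where S: "S \<noteq> {}" "S \<subset> A" "absorbing F A S" "smooth_on S (E \<inter> S \<times> S)"
      "S \<times> S \<subseteq> (link ((E \<inter> S \<times> S) ^^ m))\<^sup>*"
      using absorbing_descent[OF E less.prems(5,6)] by blast
    then have "closed_under F S" by (simp add: absorbing_def)
    then show ?thesis using IH[OF S(1,2) _ S(4) less.prems(5) S(5)] minimal_absorbing_trans[OF S(3)] by blast
  next
    case True
    have min: "minimal_absorbing F A A"
      using True absorbing_self less.prems(2) unfolding minimal_absorbing_def absorption_free_def by blast
    have "\<exists>a\<in>A. (a, a) \<in> E"
    proof -
      have Em: "E ^^ m = A \<times> A"
        using smooth_on_relpow[OF E(1) less.prems(5)] compat_relpow[OF E(2)] less.prems(6)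
        by (intro linked_full[OF True])
      \<comment> \<open>By minimality \<open>E ^^ l\<close> is not full unless \<open>l = 0\<close>,
        when \<open>E\<close> itself is full and every vertex carries a loop.\<close>
      define l where "l = (LEAST l. E ^^ Suc l = A \<times> A)"
      have l: "E ^^ Suc l = A \<times> A"
        unfolding l_def by (rule LeastI[of _ "m - 1"]) (use Em less.prems(5) in simp)
      show ?thesis
      proof (cases l)
        case 0
        then show ?thesis using l less.prems(2) by auto
      next
        case (Suc j)
        then have "E ^^ l \<noteq> A \<times> A"
          using not_less_Least[of j "\<lambda>l. E ^^ Suc l = A \<times> A"] by (auto simp: l_def)
        then obtain S M where S: "S \<noteq> {}" "S \<subset> A" "closed_under F S" "smooth_on S (E \<inter> S \<times> S)"
          "0 < M" "S \<times> S \<subseteq> (link ((E \<inter> S \<times> S) ^^ M))\<^sup>*"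
          using absorption_free_descent[OF E True _ l] Suc by blast
        then obtain J where "minimal_absorbing F S J" "\<exists>a\<in>J. (a, a) \<in> E" using IH[OF S] by blast
        then show ?thesis using S(2) unfolding minimal_absorbing_def absorbing_def by blast
      qed
    qed
    then show ?thesis using min by blast
  qed
qed

section \<open>Components of algebraic length one\<close>

lemma link_rtrancl_mono:
  assumes E: "smooth_on A E" and xy: "(x, y) \<in> (link (E ^^ i))\<^sup>*" and "x \<in> A" "i \<le> j"
  shows "(x, y) \<in> (link (E ^^ j))\<^sup>*"
  using xy
proof (induction rule: rtrancl_induct)
  case (step y z)
  have EA: "E \<subseteq> A \<times> A" "\<And>x. x \<in> A \<Longrightarrow> \<exists>y. (x, y) \<in> E" using E by (auto simp: smooth_on_def)
  have "y \<in> A" using rtrancl_link_closed[OF EA(1) step(1)] assms by blast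
  then have "(y, z) \<in> link (E ^^ j)" using link_relpow_mono[OF EA _ step(2) \<open>i \<le> j\<close>] by blast
  then show ?case using step.IH by simp
qed simp

text \<open>An edge is put in front of both walks of every link, smoothness supplying predecessors
  of the intermediate vertices. The base case links two predecessors of one vertex.\<close>

lemma link_rtrancl_pred:
  assumes E: "smooth_on A E" and xy: "(x, y) \<in> (link (E ^^ n))\<^sup>*"
    and "(x', x) \<in> E" "(y', y) \<in> E"
  shows "(x', y') \<in> (link (E ^^ Suc n))\<^sup>*"
  using xy assms(4)
proof (induction arbitrary: y' rule: rtrancl_induct)
  case base
  have "x \<in> A" using E assms(3) by (auto simp: smooth_on_def)
  then obtain c where "(x, c) \<in> E ^^ n" using smooth_on_succ[OF E] by blast
  then have "(x', c) \<in> E ^^ Suc n" "(y', c) \<in> E ^^ Suc n"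
    using assms(3) base by (blast intro: relpow_Suc_I2)+
  then show ?case unfolding link_def by blast
next
  case (step z y)
  obtain c where c: "(z, c) \<in> E ^^ n" "(y, c) \<in> E ^^ n" using step(2) by (auto simp: link_def)
  have EA: "E \<subseteq> A \<times> A" using E by (simp add: smooth_on_def)
  have "z \<in> A" using rtrancl_link_closed[OF EA step(1)] assms(3) EA by blast
  then obtain z' where z': "(z', z) \<in> E" using E by (auto simp: smooth_on_def)
  have "(z', c) \<in> E ^^ Suc n" "(y', c) \<in> E ^^ Suc n"
    using z' c step.prems by (blast intro: relpow_Suc_I2)+
  then have "(z', y') \<in> link (E ^^ Suc n)" unfolding link_def by blast
  then show ?case using step.IH[OF z'] by simp
qed

text \<open>The exponent may depend on the pair; finiteness yields a common exponent for a whole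
  class in \<open>class_link\<close>.\<close>

definition same_level :: "'a set \<Rightarrow> 'a rel \<Rightarrow> 'a rel" where
  "same_level A E = {(x, y) \<in> A \<times> A. \<exists>n. (x, y) \<in> (link (E ^^ n))\<^sup>*}"

lemma equiv_same_level:
  assumes E: "smooth_on A E"
  shows "equiv A (same_level A E)"
proof (rule equivI)
  show "same_level A E \<subseteq> A \<times> A" by (auto simp: same_level_def)
  show "refl_on A (same_level A E)" by (auto simp: refl_on_def same_level_def)
  show "sym (same_level A E)"
    by (rule symI) (auto simp: same_level_def intro: sym_link_rtrancl)
  show "trans (same_level A E)"
  proof (rule transI)
    fix x y z assume "(x, y) \<in> same_level A E" "(y, z) \<in> same_level A E"
    then obtain i j where xyz: "x \<in> A" "y \<in> A" "z \<in> A"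
      "(x, y) \<in> (link (E ^^ i))\<^sup>*" "(y, z) \<in> (link (E ^^ j))\<^sup>*" by (auto simp: same_level_def)
    then have "(x, y) \<in> (link (E ^^ max i j))\<^sup>*" "(y, z) \<in> (link (E ^^ max i j))\<^sup>*"
      using link_rtrancl_mono[OF E] by (meson max.cobounded1 max.cobounded2)+
    then show "(x, z) \<in> same_level A E" using xyz unfolding same_level_def by (blast intro: rtrancl_trans)
  qed
qed

text \<open>
  Taking predecessors is a well-defined surjective map on the finite set of classes of
  \<^const>\<open>same_level\<close>, so it is bijective, and the class of the start of an oriented path determines
  that of its end.
\<close>

locale pred_level =
  fixes A :: "'a set" and E :: "'a rel" and g :: "'a \<Rightarrow> 'a"
  assumes fin: "finite A" and smooth: "smooth_on A E" and g: "x \<in> A \<Longrightarrow> (g x, x) \<in> E"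
begin

abbreviation r :: "'a rel" where "r \<equiv> same_level A E"

lemma EA: "E \<subseteq> A \<times> A"
  using smooth by (simp add: smooth_on_def)

lemma r_refl: "x \<in> A \<Longrightarrow> (x, x) \<in> r"
  using equivE[OF equiv_same_level[OF smooth]] by (blast dest: refl_onD)

lemma r_sym: "(x, y) \<in> r \<Longrightarrow> (y, x) \<in> r"
  using equivE[OF equiv_same_level[OF smooth]] by (blast dest: symD)

lemma r_trans: "(x, y) \<in> r \<Longrightarrow> (y, z) \<in> r \<Longrightarrow> (x, z) \<in> r"
  using equivE[OF equiv_same_level[OF smooth]] by (blast dest: transD)

lemma r_A: "(x, y) \<in> r \<Longrightarrow> x \<in> A \<and> y \<in> A"
  by (auto simp: same_level_def)

lemma g_A: "x \<in> A \<Longrightarrow> g x \<in> A"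
  using g EA by blast

lemma r_pred:
  assumes "(x, y) \<in> r" "(x', x) \<in> E" "(y', y) \<in> E"
  shows "(x', y') \<in> r"
proof -
  obtain n where "(x, y) \<in> (link (E ^^ n))\<^sup>*" using assms by (auto simp: same_level_def)
  from link_rtrancl_pred[OF smooth this assms(2,3)] show ?thesis
    using assms EA unfolding same_level_def by blast
qed

lemma r_g: "(x, y) \<in> r \<Longrightarrow> (g x, g y) \<in> r"
  by (rule r_pred) (auto dest: r_A intro: g)

lemma r_edge: "(x, y) \<in> E \<Longrightarrow> (x, g y) \<in> r"
  by (rule r_pred[OF r_refl[of y]]) (use EA g in auto)

lemma r_g_cancel:
  assumes xy: "x \<in> A" "y \<in> A" "(g x, g y) \<in> r"
  shows "(x, y) \<in> r"
proof -
  note eq = equiv_same_level[OF smooth]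
  \<comment> \<open>This is the map induced by \<open>g\<close> on classes; saturating with
    \<open>r\<close> turns the image of a class into a full class.\<close>
  let ?h = "\<lambda>X. r `` (g ` X)"
  have h: "?h (r `` {x}) = r `` {g x}" if x: "x \<in> A" for x
  proof
    show "?h (r `` {x}) \<subseteq> r `` {g x}" using r_g r_trans by blast
    show "r `` {g x} \<subseteq> ?h (r `` {x})" using r_refl[OF x] by blast
  qed
  have "?h ` (A // r) = A // r"
  proof
    show "?h ` (A // r) \<subseteq> A // r"
    proof clarify
      fix X assume "X \<in> A // r"
      then obtain x where x: "x \<in> A" "X = r `` {x}" by (rule quotientE)
      then have "?h X = r `` {g x}" using h by simp
      then show "?h X \<in> A // r" using quotientI[OF g_A[OF x(1)], of r] by simp
    qed
    show "A // r \<subseteq> ?h ` (A // r)"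
    proof
      fix X assume "X \<in> A // r"
      then obtain x where x: "x \<in> A" "X = r `` {x}" by (rule quotientE)
      \<comment> \<open>For surjectivity: \<open>x\<close> and \<open>g y\<close> are both
        predecessors of \<open>y\<close>, so the class of \<open>x\<close> is the image of the class
        of \<open>y\<close>.\<close>
      then obtain y where y: "(x, y) \<in> E" using smooth by (auto simp: smooth_on_def)
      then have "y \<in> A" using EA by blast
      have "X = r `` {g y}" using equiv_class_eq[OF eq r_edge[OF y]] x by simp
      also have "\<dots> = ?h (r `` {y})" using h[OF \<open>y \<in> A\<close>] by simp
      finally show "X \<in> ?h ` (A // r)" using quotientI[OF \<open>y \<in> A\<close>, of r] by blast
    qed
  qed
  moreover have "finite (A // r)" using fin r_A by (intro finite_quotient) auto
  ultimately have inj: "inj_on ?h (A // r)" by (intro eq_card_imp_inj_on) auto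
  have "?h (r `` {x}) = ?h (r `` {y})"
    using h xy equiv_class_eq[OF eq xy(3)] by simp
  then have "r `` {x} = r `` {y}"
    using inj_onD[OF inj] quotientI[OF xy(1)] quotientI[OF xy(2)] by blast
  then show ?thesis using r_refl[OF xy(2)] by blast
qed

lemma r_funpow: "(x, y) \<in> r \<Longrightarrow> ((g ^^ n) x, (g ^^ n) y) \<in> r"
  by (induction n) (auto intro: r_g)

lemma funpow_A: "x \<in> A \<Longrightarrow> (g ^^ n) x \<in> A"
  by (induction n) (auto intro: g_A)

lemma r_funpow_cancel: "x \<in> A \<Longrightarrow> y \<in> A \<Longrightarrow> ((g ^^ n) x, (g ^^ n) y) \<in> r \<Longrightarrow> (x, y) \<in> r"
  by (induction n) (auto intro: r_g_cancel funpow_A)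

text \<open>A forward edge costs one more \<open>g\<close> at the current vertex, a backward edge
  one more \<open>g\<close> at the start. Counting the two directions separately avoids inverting
  \<open>g\<close> on classes.\<close>

lemma path_level:
  assumes h0: "h 0 \<in> A"
    and h: "\<And>i. i < length ds \<Longrightarrow> if ds ! i then (h i, h (Suc i)) \<in> E else (h (Suc i), h i) \<in> E"
    and i: "i \<le> length ds"
  shows "((g ^^ count_list (take i ds) False) (h 0), (g ^^ count_list (take i ds) True) (h i)) \<in> r"
  using i
proof (induction i)
  case 0
  then show ?case using r_refl h0 by simp
next
  case (Suc i)
  let ?F = "count_list (take i ds) False" and ?T = "count_list (take i ds) True"
  have IH: "((g ^^ ?F) (h 0), (g ^^ ?T) (h i)) \<in> r" using Suc by simp
  have tk: "take (Suc i) ds = take i ds @ [ds ! i]" using Suc.prems by (simp add: take_Suc_conv_app_nth)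
  show ?case
  proof (cases "ds ! i")
    case True
    then have "(h i, g (h (Suc i))) \<in> r" using h[of i] Suc.prems r_edge by simp
    then have "((g ^^ ?T) (h i), (g ^^ Suc ?T) (h (Suc i))) \<in> r"
      using r_funpow[of "h i" "g (h (Suc i))" ?T] by (simp add: funpow_swap1)
    then show ?thesis using r_trans[OF IH] True by (simp add: tk)
  next
    case False
    then have "(h (Suc i), g (h i)) \<in> r" using h[of i] Suc.prems r_edge by simp
    then have "((g ^^ ?T) (h (Suc i)), g ((g ^^ ?T) (h i))) \<in> r"
      using r_funpow[of "h (Suc i)" "g (h i)" ?T] by (simp add: funpow_swap1)
    then have "(g ((g ^^ ?F) (h 0)), (g ^^ ?T) (h (Suc i))) \<in> r"
      using r_trans[OF r_g[OF IH]] r_sym by blast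
    then show ?thesis using False by (simp add: tk)
  qed
qed

text \<open>There is one more forward edge than backward edges, so \<open>path_level\<close> leaves
  a single \<open>g\<close> after cancellation.\<close>

lemma level_of_closed_path:
  assumes a: "h 0 = a" "h (length ds) = a" "a \<in> A" and "path_alg_length ds = 1"
    and h: "\<And>i. i < length ds \<Longrightarrow> if ds ! i then (h i, h (Suc i)) \<in> E else (h (Suc i), h i) \<in> E"
  shows "(a, g a) \<in> r"
proof -
  have T: "count_list ds True = Suc (count_list ds False)"
    using assms(4) by (simp add: path_alg_length_def)
  have "((g ^^ count_list ds False) a, (g ^^ count_list ds True) a) \<in> r"
    using path_level[of h ds "length ds"] a h by simp
  then have "((g ^^ count_list ds False) a, (g ^^ count_list ds False) (g a)) \<in> r"
    by (simp add: T funpow_swap1)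
  then show ?thesis using r_funpow_cancel a g_A by blast
qed

text \<open>The predecessor map fixes the class of \<open>a\<close>, which gives closure under
  predecessors; its injectivity on classes gives closure under successors.\<close>

lemma class_closed:
  assumes a: "(a, g a) \<in> r" and "(x, y) \<in> E"
  shows "(a, x) \<in> r \<longleftrightarrow> (a, y) \<in> r"
proof
  assume "(a, x) \<in> r"
  from r_trans[OF r_trans[OF r_sym[OF a] this] r_edge[OF assms(2)]]
  have "(g a, g y) \<in> r" .
  then show "(a, y) \<in> r" using r_g_cancel r_A[OF a] assms(2) EA by blast
next
  assume "(a, y) \<in> r"
  from r_trans[OF a r_g[OF this]] show "(a, x) \<in> r"
    using r_sym[OF r_edge[OF assms(2)]] r_trans by blast
qed

text \<open>The sum of finitely many exponents bounds them all, and the added \<open>Suc\<close>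
  makes it positive. By \<open>class_closed\<close> every walk touching \<open>W\<close> runs inside
  \<open>W\<close>, so the fences survive restriction to \<open>W\<close>.\<close>

lemma class_link:
  assumes a: "(a, g a) \<in> r"
  defines "W \<equiv> r `` {a}"
  shows "smooth_on W (E \<inter> W \<times> W)"
    and "\<exists>n>0. (\<forall>x\<in>W. (a, x) \<in> (link (E ^^ n))\<^sup>*) \<and> W \<times> W \<subseteq> (link ((E \<inter> W \<times> W) ^^ n))\<^sup>*"
proof -
  have edge: "x \<in> W \<longleftrightarrow> y \<in> W" if "(x, y) \<in> E" for x y
    using class_closed[OF a that] by (simp add: W_def)
  have WA: "W \<subseteq> A" using r_A by (auto simp: W_def)
  show "smooth_on W (E \<inter> W \<times> W)"
    unfolding smooth_on_def
  proof (intro conjI ballI)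
    fix x assume x: "x \<in> W"
    then have "x \<in> A" using WA by blast
    then obtain y z where "(x, y) \<in> E" "(z, x) \<in> E" using smooth unfolding smooth_on_def by blast
    then show "\<exists>y. (x, y) \<in> E \<inter> W \<times> W" "\<exists>y. (y, x) \<in> E \<inter> W \<times> W" using x edge by blast+
  qed simp
  have "\<exists>n. (a, x) \<in> (link (E ^^ n))\<^sup>*" if "x \<in> W" for x
    using that by (auto simp: W_def same_level_def)
  then obtain n where n: "\<And>x. x \<in> W \<Longrightarrow> (a, x) \<in> (link (E ^^ n x))\<^sup>*" by metis
  define N where "N = Suc (\<Sum>x\<in>W. n x)"
  have finW: "finite W" using WA fin finite_subset by blast
  have aW: "a \<in> W" using a r_A r_refl by (auto simp: W_def)
  have N: "(a, x) \<in> (link (E ^^ N))\<^sup>*" if x: "x \<in> W" for x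
  proof (rule link_rtrancl_mono[OF smooth n[OF x]])
    show "n x \<le> N" using member_le_sum[of x W n] finW x by (simp add: N_def)
  qed (use aW WA in blast)
  have pow: "(x, y) \<in> (E \<inter> W \<times> W) ^^ j \<and> y \<in> W" if "x \<in> W" "(x, y) \<in> E ^^ j" for x y j
    using that(2)
  proof (induction j arbitrary: y)
    case 0
    then show ?case using that(1) by simp
  next
    case (Suc j)
    then obtain z where z: "(x, z) \<in> E ^^ j" "(z, y) \<in> E" by auto
    then have "(x, z) \<in> (E \<inter> W \<times> W) ^^ j" "z \<in> W" using Suc.IH by blast+
    then show ?case using z edge by auto
  qed
  have pow_back: "x \<in> W" if "y \<in> W" "(x, y) \<in> E ^^ j" for x y j
    using that(2,1)
  proof (induction j arbitrary: y)
    case (Suc j)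
    then obtain z where "(x, z) \<in> E ^^ j" "(z, y) \<in> E" by auto
    then show ?case using Suc edge by blast
  qed simp
  have lnk: "(a, x) \<in> (link ((E \<inter> W \<times> W) ^^ N))\<^sup>* \<and> x \<in> W" if "(a, x) \<in> (link (E ^^ N))\<^sup>*" for x
    using that
  proof (induction rule: rtrancl_induct)
    case (step y z)
    then obtain c where c: "(y, c) \<in> E ^^ N" "(z, c) \<in> E ^^ N" by (auto simp: link_def)
    then have "z \<in> W" using step pow pow_back by blast
    then have "(y, z) \<in> link ((E \<inter> W \<times> W) ^^ N)" using c step pow unfolding link_def by blast
    then show ?case using step \<open>z \<in> W\<close> by (meson rtrancl.rtrancl_into_rtrancl)
  qed (use aW in simp)
  have "(x, y) \<in> (link ((E \<inter> W \<times> W) ^^ N))\<^sup>*" if "x \<in> W" "y \<in> W" for x y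
  proof -
    have "(a, x) \<in> (link ((E \<inter> W \<times> W) ^^ N))\<^sup>*" "(a, y) \<in> (link ((E \<inter> W \<times> W) ^^ N))\<^sup>*"
      using lnk N that by blast+
    then show ?thesis using sym_link_rtrancl rtrancl_trans by metis
  qed
  then show "\<exists>n>0. (\<forall>x\<in>W. (a, x) \<in> (link (E ^^ n))\<^sup>*) \<and> W \<times> W \<subseteq> (link ((E \<inter> W \<times> W) ^^ n))\<^sup>*"
    using N by (intro exI[of _ N]) (auto simp: N_def)
qed

end

context taylor_clone
begin

text \<open>Linkedness is compatible with the operations, and idempotence keeps the class of
  \<open>a\<close> fixed. For absorption, arguments from \<open>W\<close> are replaced by one
  element of \<open>I\<close>: the value then lies in \<open>I\<close>, and it is linked to the
  original value.\<close>

lemma class_absorbing: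
  assumes E: "smooth_on A E" "compatible F E" and n: "0 < n" and W: "W \<subseteq> A" "a \<in> W"
    and Wa: "\<And>x. x \<in> W \<longleftrightarrow> (a, x) \<in> (link (E ^^ n))\<^sup>*"
  shows "closed_under F W" and "absorbing F A I \<Longrightarrow> I \<noteq> {} \<Longrightarrow> I \<subseteq> W \<Longrightarrow> absorbing F A W"
proof -
  have En: "smooth_on A (E ^^ n)" "compatible F (E ^^ n)"
    using smooth_on_relpow[OF E(1) n] compat_relpow[OF E(2)] by auto
  show closed: "closed_under F W"
    unfolding closed_under_def
  proof (intro allI ballI impI)
    fix m f b
    assume f: "f \<in> F m" and b: "\<forall>i<m. b i \<in> W"
    have "(f (\<lambda>_. a), f b) \<in> (link (E ^^ n))\<^sup>*"
      by (rule link_rtrancl_compat[OF En f]) (use b W Wa in auto)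
    then show "f b \<in> W" using idem[OF f, of a] W Wa by auto
  qed
  assume I: "absorbing F A I" "I \<noteq> {}" "I \<subseteq> W"
  then obtain m f where f: "f \<in> F m" "absorbs_by A m f I" by (auto simp: absorbing_def)
  obtain i0 where i0: "i0 \<in> I" using I by blast
  have "absorbs_by A m f W"
    unfolding absorbs_by_def
  proof (intro allI impI)
    fix k b
    assume k: "k < m" and bA: "\<forall>i<m. b i \<in> A" and bW: "\<forall>i<m. i \<noteq> k \<longrightarrow> b i \<in> W"
    let ?c = "\<lambda>i. if i = k then b k else i0"
    have fI: "f ?c \<in> I"
      by (rule absorbs_byD[OF f(2) k]) (use bA k i0 I W in auto)
    have "(f ?c, f b) \<in> (link (E ^^ n))\<^sup>*"
    proof (rule link_rtrancl_compat[OF En f(1)])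
      fix i assume i: "i < m"
      show "?c i \<in> A" using bA k i0 I W by auto
      show "(?c i, b i) \<in> (link (E ^^ n))\<^sup>*"
      proof (cases "i = k")
        case False
        then have "b i \<in> W" "i0 \<in> W" using bW i i0 I by auto
        then have "(a, i0) \<in> (link (E ^^ n))\<^sup>*" "(a, b i) \<in> (link (E ^^ n))\<^sup>*"
          using iffD1[OF Wa] by simp_all
        then show ?thesis using False rtrancl_trans[OF sym_link_rtrancl] by simp
      qed simp
    qed
    moreover have "f ?c \<in> W" using fI I(3) by blast
    ultimately have "(a, f b) \<in> (link (E ^^ n))\<^sup>*" using rtrancl_trans[OF iffD1[OF Wa]] by blast
    then show "f b \<in> W" by (rule iffD2[OF Wa])
  qed
  then show "absorbing F A W" unfolding absorbing_def using closed f(1) W(1) by blast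
qed

end

section \<open>The clone of term operations\<close>

definition term_ops :: "'f signature \<Rightarrow> ('f, 'a) alg \<Rightarrow> nat \<Rightarrow> ((nat \<Rightarrow> 'a) \<Rightarrow> 'a) set" where
  "term_ops sg A n = {\<lambda>a. eval A a t | t. t \<in> terms_of_arity sg n}"

text \<open>Needed to realise \<open>star\<close> by a term, as \<open>rename\<close> replaces
  variables by variables only.\<close>

primrec subst :: "('v \<Rightarrow> ('f, 'w) trm) \<Rightarrow> ('f, 'v) trm \<Rightarrow> ('f, 'w) trm" where
  "subst \<sigma> (Var x) = \<sigma> x"
| "subst \<sigma> (App f ts) = App f (map (subst \<sigma>) ts)"

lemma eval_subst: "eval A v (subst \<sigma> t) = eval A (\<lambda>x. eval A v (\<sigma> x)) t"
  by (induction t) (auto simp: comp_def intro!: arg_cong[of _ _ "opn A _"])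

lemma wf_subst: "wf_trm sg t \<Longrightarrow> (\<And>x. x \<in> vars t \<Longrightarrow> wf_trm sg (\<sigma> x)) \<Longrightarrow> wf_trm sg (subst \<sigma> t)"
  by (induction t) (auto simp: list_all_iff)

lemma vars_subst: "vars (subst \<sigma> t) = (\<Union>x\<in>vars t. vars (\<sigma> x))"
  by (induction t) auto

lemma eval_rename: "eval A v (rename p t) = eval A (\<lambda>x. v (p x)) t"
  by (induction t) (auto simp: comp_def intro!: arg_cong[of _ _ "opn A _"])

lemma wf_rename: "wf_trm sg (rename p t) = wf_trm sg t"
  by (induction t) (auto simp: list_all_iff)

lemma eval_cong: "(\<And>x. x \<in> vars t \<Longrightarrow> v x = w x) \<Longrightarrow> eval A v t = eval A w t"
proof (induction t)
  case (App f ts)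
  then have "map (eval A v) ts = map (eval A w) ts" by auto
  then show ?case by (simp only: eval.simps)
qed simp

lemma eval_in_subuniverse:
  assumes "subuniverse sg A B" "wf_trm sg t" "\<And>x. x \<in> vars t \<Longrightarrow> v x \<in> B"
  shows "eval A v t \<in> B"
  using assms(2,3)
proof (induction t)
  case (App f ts)
  then have "set (map (eval A v) ts) \<subseteq> B" by (auto simp: list_all_iff)
  then show ?case using App.prems assms(1) by (auto simp: subuniverse_def)
qed simp

lemma opn_alg_square: "opn (alg_square A) f ps = (opn A f (map fst ps), opn A f (map snd ps))"
  by (simp add: alg_square_def)

lemma eval_alg_square:
  "eval (alg_square A) v t = (eval A (\<lambda>x. fst (v x)) t, eval A (\<lambda>x. snd (v x)) t)"
proof (induction t)
  case (App f ts)
  have "map fst (map (eval (alg_square A) v) ts) = map (eval A (\<lambda>x. fst (v x))) ts"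
    "map snd (map (eval (alg_square A) v) ts) = map (eval A (\<lambda>x. snd (v x))) ts"
    using App by auto
  then show ?case by (simp only: eval.simps opn_alg_square)
qed simp

section \<open>Translation between algebras and clones of term operations\<close>

lemma subuniverse_closed_under:
  assumes "subuniverse sg A B"
  shows "closed_under (term_ops sg A) B"
  unfolding closed_under_def term_ops_def
  using eval_in_subuniverse[OF assms] by (fastforce simp: terms_of_arity_def terms_def)

text \<open>A basic operation is itself a term operation. A nullary symbol is treated as a unary
  term, terms having positive arity, and its dummy argument takes a value \<open>b\<close> from the
  nonempty \<open>B\<close>.\<close>

lemma closed_under_subuniverse:
  assumes "closed_under (term_ops sg A) B" "B \<subseteq> universe A" "B \<noteq> {}"
  shows "subuniverse sg A B"
  unfolding subuniverse_def
proof (intro conjI allI impI)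
  fix f n as
  assume f: "sg f = Some n" "length as = n" "set as \<subseteq> B"
  obtain b where b: "b \<in> B" using assms(3) by blast
  let ?t = "App f (map Var [0..<n]) :: (_, nat) trm" and ?m = "max 1 n"
  let ?a = "\<lambda>i. if i < n then as ! i else b"
  have "?t \<in> terms_of_arity sg ?m"
    using f by (auto simp: terms_of_arity_def terms_def list_all_iff)
  then have "(\<lambda>a. eval A a ?t) \<in> term_ops sg A ?m" unfolding term_ops_def by blast
  moreover have "?a i \<in> B" for i using f b by auto
  ultimately have "eval A ?a ?t \<in> B" using closed_underD[OF assms(1), of "\<lambda>a. eval A a ?t" ?m ?a] by blast
  moreover have "map ?a [0..<n] = as" using f by (auto intro: nth_equalityI)
  ultimately show "opn A f as \<in> B" by (simp add: comp_def)
qed (rule assms(2))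

lemma subuniverse_square_compatible:
  assumes "subuniverse sg (alg_square A) E"
  shows "compatible (term_ops sg A) E"
  unfolding compatible_def
proof (intro allI ballI impI)
  fix n f a b
  assume f: "f \<in> term_ops sg A n" and ab: "\<forall>i<n. (a i, b i) \<in> E"
  obtain t where t: "f = (\<lambda>a. eval A a t)" "wf_trm sg t" "vars t \<subseteq> {..<n}"
    using f by (auto simp: term_ops_def terms_of_arity_def terms_def)
  have "eval (alg_square A) (\<lambda>i. (a i, b i)) t \<in> E"
    by (rule eval_in_subuniverse[OF assms t(2)]) (use t(3) ab in auto)
  then show "(f a, f b) \<in> E" by (simp add: eval_alg_square t(1))
qed

lemma absorbing_term_ops:
  assumes "B \<noteq> {}"
  shows "absorbing_subuniverse sg A B \<longleftrightarrow> absorbing (term_ops sg A) (universe A) B"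
proof -
  have "subuniverse sg A B \<longleftrightarrow> B \<subseteq> universe A \<and> closed_under (term_ops sg A) B"
  proof
    assume "subuniverse sg A B"
    then show "B \<subseteq> universe A \<and> closed_under (term_ops sg A) B"
      using subuniverse_closed_under[of sg A B] by (simp add: subuniverse_def)
  qed (use closed_under_subuniverse[OF _ _ assms] in blast)
  moreover have "(\<exists>t\<in>terms_of_arity sg n. absorbs_by (universe A) n (\<lambda>a. eval A a t) B) \<longleftrightarrow>
    (\<exists>f\<in>term_ops sg A n. absorbs_by (universe A) n f B)" for n
    unfolding term_ops_def by blast
  ultimately show ?thesis
    unfolding absorbing_subuniverse_def absorbing_def absorbs_by_def by simp
qed

lemma minimal_absorbing_term_ops:
  "minimal_absorbing (term_ops sg A) (universe A) J \<Longrightarrow> minimal_absorbing_subuniverse sg A J"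
  unfolding minimal_absorbing_def minimal_absorbing_subuniverse_def
  using absorbing_term_ops by metis

lemma taylor_clone_term_ops:
  fixes sg :: "'f signature" and A :: "('f, 'a) alg"
  assumes \<Sigma>: "\<Sigma> \<subseteq> terms sg \<times> terms sg" and taylor: "taylor_variety sg \<Sigma>"
    and A: "A \<in> variety sg \<Sigma>" "finite (universe A)"
  shows "taylor_clone (term_ops sg A) (universe A)"
proof
  have alg: "is_algebra sg A" using A by (simp add: variety_def)
  \<comment> \<open>Identities of the variety are defined through algebras on terms; this carries
    them over to the carrier type of \<open>A\<close>.\<close>
  note sat = variety_satisfies_any_type[OF \<Sigma> _ _ _ A(1)]
  show "finite (universe A)" by (rule A(2))
  show "closed_under (term_ops sg A) (universe A)"
    using alg by (intro subuniverse_closed_under) (auto simp: is_algebra_def subuniverse_def)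
  show "(\<lambda>a. a 0) \<in> term_ops sg A 1"
    unfolding term_ops_def by (auto simp: terms_of_arity_def terms_def intro!: exI[of _ "Var 0"])
  show "0 < n" if "f \<in> term_ops sg A n" for f n
    using that by (auto simp: term_ops_def terms_of_arity_def)
  show "f a = f b" if "f \<in> term_ops sg A n" "\<And>i. i < n \<Longrightarrow> a i = b i" for f n a b
    using that by (auto simp: term_ops_def terms_of_arity_def intro!: eval_cong)
  show "f (\<lambda>_. x) = x" if f: "f \<in> term_ops sg A n" and x: "x \<in> universe A" for f n x
  proof -
    obtain t where t: "f = (\<lambda>a. eval A a t)" "t \<in> terms sg"
      using f by (auto simp: term_ops_def terms_of_arity_def)
    have "variety_satisfies sg \<Sigma> (rename (\<lambda>_. 0) t) (Var 0)"
      using taylor t by (auto simp: taylor_variety_def idempotent_variety_def idempotent_term_def)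
    then have "satisfies A (rename (\<lambda>_. 0) t) (Var 0)"
      using t by (intro sat) (auto simp: terms_def wf_rename)
    then have "eval A (\<lambda>_. x) (rename (\<lambda>_. 0 :: nat) t) = eval A (\<lambda>_. x) (Var 0)"
      unfolding satisfies_def by (rule allE[of _ "\<lambda>_. x"]) (use x in auto)
    then show ?thesis by (simp add: eval_rename t)
  qed
  show "(\<lambda>a. f (\<lambda>i. a (\<pi> i))) \<in> term_ops sg A m"
    if f: "f \<in> term_ops sg A n" and m: "0 < m" and \<pi>: "\<And>i. i < n \<Longrightarrow> \<pi> i < m" for f n m \<pi>
  proof -
    obtain t where t: "f = (\<lambda>a. eval A a t)" "t \<in> terms_of_arity sg n"
      using f by (auto simp: term_ops_def)
    then have "rename \<pi> t \<in> terms_of_arity sg m"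
      using m \<pi> by (auto simp: terms_of_arity_def terms_def wf_rename trm.set_map)
    then show ?thesis unfolding term_ops_def
      by (auto simp: t eval_rename intro!: exI[of _ "rename \<pi> t"])
  qed
  show "star m f g \<in> term_ops sg A (n * m)"
    if f: "f \<in> term_ops sg A n" and g: "g \<in> term_ops sg A m" for f n g m
  proof -
    obtain t u where t: "f = (\<lambda>a. eval A a t)" "t \<in> terms_of_arity sg n"
      and u: "g = (\<lambda>a. eval A a u)" "u \<in> terms_of_arity sg m"
      using f g by (auto simp: term_ops_def)
    \<comment> \<open>Variable \<open>i\<close> of \<open>t\<close> is replaced by the copy of
      \<open>u\<close> on the \<open>i\<close>-th block of \<open>m\<close> variables.\<close>
    let ?s = "subst (\<lambda>i. rename (\<lambda>j. i * m + j) u) t"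
    have ix: "i * m + j < n * m" if "i < n" "j < m" for i j
    proof -
      have "i * m + j < Suc i * m" using that by simp
      also have "\<dots> \<le> n * m" using that by (intro mult_le_mono1) simp
      finally show ?thesis .
    qed
    have "?s \<in> terms_of_arity sg (n * m)"
      using t u ix
      by (fastforce simp: terms_of_arity_def terms_def vars_subst trm.set_map wf_rename intro!: wf_subst)
    moreover have "star m f g = (\<lambda>a. eval A a ?s)"
      by (simp add: star_def t u eval_subst eval_rename)
    ultimately show ?thesis unfolding term_ops_def by blast
  qed
  obtain k t where t: "taylor_term sg \<Sigma> k t" using taylor by (auto simp: taylor_variety_def)
  have "taylor_op (universe A) k (\<lambda>a. eval A a t)"
    unfolding taylor_op_def
  proof (intro allI impI)
    fix j assume "j < k"
    then obtain p q where pq: "\<forall>i<k. p i \<in> {0, 1} \<and> q i \<in> {0, 1}" "p j = 0" "q j = 1"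
      and vs: "variety_satisfies sg \<Sigma> (rename p t) (rename q t)"
      using t unfolding taylor_term_def by blast
    have tk: "wf_trm sg t" "vars t \<subseteq> {..<k}"
      using t by (auto simp: taylor_term_def terms_of_arity_def terms_def)
    have sat: "satisfies A (rename p t) (rename q t)"
      using vs tk by (intro sat) (auto simp: terms_def wf_rename)
    have "eval A (\<lambda>i. a (p i)) t = eval A (\<lambda>i. a (q i)) t"
      if a: "a 0 \<in> universe A" "a 1 \<in> universe A" for a
    proof -
      \<comment> \<open>\<open>satisfies\<close> needs a valuation with all values in the universe,
        whereas only \<open>a 0\<close> and \<open>a 1\<close> are known to lie there.\<close>
      let ?v = "\<lambda>i :: nat. if i = 0 then a 0 else a 1"
      have "eval A ?v (rename p t) = eval A ?v (rename q t)"
        using sat a unfolding satisfies_def by (auto simp: image_subset_iff)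
      moreover have "eval A (\<lambda>i. ?v (r i)) t = eval A (\<lambda>i. a (r i)) t"
        if "\<forall>i<k. r i \<in> {0, 1}" for r
        by (rule eval_cong) (use that tk in auto)
      ultimately show ?thesis using pq(1) by (simp add: eval_rename)
    qed
    moreover have "\<forall>i<k. p i < 2 \<and> q i < 2" using pq(1) by fastforce
    ultimately show "\<exists>p q :: nat \<Rightarrow> nat. (\<forall>i<k. p i < 2 \<and> q i < 2) \<and> p j = 0 \<and> q j = 1 \<and>
      (\<forall>a. a 0 \<in> universe A \<longrightarrow> a 1 \<in> universe A \<longrightarrow>
        eval A (\<lambda>i. a (p i)) t = eval A (\<lambda>i. a (q i)) t)"
      using pq by (intro exI[of _ p] exI[of _ q]) simp
  qed
  then show "\<exists>n. \<exists>t\<in>term_ops sg A n. taylor_op (universe A) n t"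
    using t unfolding taylor_term_def term_ops_def by blast
qed

section \<open>Oriented paths as sequences of vertices\<close>

lemma connected_viaE:
  assumes "connected_via G ds a b"
  obtains h where "h 0 = a" "h (length ds) = b" "\<And>i. i \<le> length ds \<Longrightarrow> h i \<in> pverts G"
    "\<And>i. i < length ds \<Longrightarrow>
      if ds ! i then (h i, h (Suc i)) \<in> parcs G else (h (Suc i), h i) \<in> parcs G"
proof -
  obtain h where h: "digraph_hom (oriented_path ds) G h" "h 0 = a" "h (length ds) = b"
    using assms by (auto simp: connected_via_def)
  have "h i \<in> pverts G" if "i \<le> length ds" for i
    using h(1) that by (auto simp: digraph_hom_def oriented_path_def)
  moreover have "if ds ! i then (h i, h (Suc i)) \<in> parcs G else (h (Suc i), h i) \<in> parcs G"
    if "i < length ds" for i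
  proof -
    have "(if ds ! i then (i, Suc i) else (Suc i, i)) \<in> parcs (oriented_path ds)"
      using that by (auto simp: oriented_path_def)
    then show ?thesis using h(1) by (fastforce simp: digraph_hom_def split: if_splits)
  qed
  ultimately show thesis using h that by blast
qed

lemma connected_via_induced:
  "connected_via (induced_digraph G W) ds a b \<Longrightarrow> W \<subseteq> pverts G \<Longrightarrow> connected_via G ds a b"
  unfolding connected_via_def digraph_hom_def induced_digraph_def by fastforce

lemma path_in_invariant:
  assumes W: "\<And>x y. (x, y) \<in> E \<Longrightarrow> x \<in> W \<longleftrightarrow> y \<in> W"
    and h: "\<And>i. i < length ds \<Longrightarrow> if ds ! i then (h i, h (Suc i)) \<in> E else (h (Suc i), h i) \<in> E"
  shows "h 0 \<in> W \<longleftrightarrow> h (length ds) \<in> W"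
proof -
  have "i \<le> length ds \<Longrightarrow> h 0 \<in> W \<longleftrightarrow> h i \<in> W" for i
  proof (induction i)
    case (Suc i)
    then show ?case using h[of i] W by (auto split: if_splits)
  qed simp
  then show ?thesis by blast
qed

theorem theorem3p6:
  fixes sg :: "'f signature"
    and \<Sigma> :: "(('f, nat) trm \<times> ('f, nat) trm) set"
    and A :: "('f, 'a) alg"
    and G :: "'a pair_pre_digraph"
  assumes "\<Sigma> \<subseteq> terms sg \<times> terms sg"
    and "taylor_variety sg \<Sigma>"
    and "A \<in> variety sg \<Sigma>"
    and "finite (universe A)"
    and "pair_fin_digraph G"
    and "pverts G = universe A"
    and "smooth G"
    and "has_alg_length G 1"
    and "subuniverse sg (alg_square A) (parcs G)"
  shows "(\<exists>a \<in> universe A. (a, a) \<in> parcs G) \<and>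
    ((\<exists>I W. I \<noteq> {} \<and> absorbing_subuniverse sg A I \<and>
            W \<in> weak_components G \<and> I \<subseteq> W \<and> has_alg_length (induced_digraph G W) 1)
     \<longrightarrow> (\<exists>J. minimal_absorbing_subuniverse sg A J \<and> (\<exists>a \<in> J. (a, a) \<in> parcs G)))"
proof -
  let ?F = "term_ops sg A" and ?A = "universe A" and ?E = "parcs G"
  interpret taylor_clone ?F ?A by (rule taylor_clone_term_ops[OF assms(1-4)])
  have E: "smooth_on ?A ?E" "compatible ?F ?E"
    using assms(6,7,9) subuniverse_square_compatible[OF assms(9)]
    by (auto simp: smooth_on_def smooth_def subuniverse_def alg_square_def)
  have "\<forall>x\<in>?A. \<exists>y. (y, x) \<in> ?E" using E by (simp add: smooth_on_def)
  then obtain g where g: "\<And>x. x \<in> ?A \<Longrightarrow> (g x, x) \<in> ?E" by metis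
  interpret P: pred_level ?A ?E g by unfold_locales (use fin E g in auto)
  let ?W = "\<lambda>a. P.r `` {a}"

  \<comment> \<open>A class fixed by the predecessor map is a subuniverse with a linked power, so
    the inductive theorem applies to it as a digraph of its own. This serves both claims.\<close>
  have component: "closed_under ?F (?W a) \<and>
      (\<exists>J. minimal_absorbing ?F (?W a) J \<and> (\<exists>c\<in>J. (c, c) \<in> ?E)) \<and>
      (\<forall>I. absorbing ?F ?A I \<longrightarrow> I \<noteq> {} \<longrightarrow> I \<subseteq> ?W a \<longrightarrow> absorbing ?F ?A (?W a))"
    if a: "(a, g a) \<in> P.r" for a
  proof -
    obtain n where n: "0 < n" "\<forall>x\<in>?W a. (a, x) \<in> (link (?E ^^ n))\<^sup>*"
      "?W a \<times> ?W a \<subseteq> (link ((?E \<inter> ?W a \<times> ?W a) ^^ n))\<^sup>*"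
      using P.class_link(2)[OF a] by blast
    have WA: "?W a \<subseteq> ?A" "a \<in> ?A" "a \<in> ?W a" using P.r_A a P.r_refl by blast+
    have "(a, x) \<in> P.r" if "(a, x) \<in> (link (?E ^^ n))\<^sup>*" for x
      using rtrancl_link_closed[OF P.EA that WA(2)] WA(2) that unfolding same_level_def by blast
    then have Wa: "x \<in> ?W a \<longleftrightarrow> (a, x) \<in> (link (?E ^^ n))\<^sup>*" for x using n(2) by blast
    note cl = class_absorbing[OF E n(1) WA(1,3) Wa]
    have "\<exists>J. minimal_absorbing ?F (?W a) J \<and> (\<exists>c\<in>J. (c, c) \<in> ?E \<inter> ?W a \<times> ?W a)"
      using restrict[OF WA(1) cl(1)] WA(3) P.class_link(1)[OF a] compatible_Int_Times[OF E(2) cl(1)]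
        n(1,3) by (intro loop_in_minimal_absorbing) auto
    then show ?thesis using cl by blast
  qed

  obtain a ds where a: "a \<in> ?A" "path_alg_length ds = 1" "connected_via G ds a a"
    using assms(6,8) by (auto simp: has_alg_length_def closed_alg_length_def)
  obtain h where "h 0 = a" "h (length ds) = a"
    "\<And>i. i < length ds \<Longrightarrow> if ds ! i then (h i, h (Suc i)) \<in> ?E else (h (Suc i), h i) \<in> ?E"
    using a(3) by (rule connected_viaE) blast
  then have "(a, g a) \<in> P.r" using a by (intro P.level_of_closed_path[of h a ds]) auto
  then obtain J c where "minimal_absorbing ?F (?W a) J" "c \<in> J" "(c, c) \<in> ?E"
    using component by blast
  then have loop: "\<exists>a\<in>?A. (a, a) \<in> ?E" using P.EA by blast

  have "\<exists>J. minimal_absorbing_subuniverse sg A J \<and> (\<exists>a\<in>J. (a, a) \<in> ?E)"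
    if I: "I \<noteq> {}" "absorbing_subuniverse sg A I" "W \<in> weak_components G" "I \<subseteq> W"
      "has_alg_length (induced_digraph G W) 1" for I W
  proof -
    obtain x where x: "x \<in> ?A" and W: "\<And>y. y \<in> W \<longleftrightarrow> y \<in> ?A \<and> (\<exists>ds. connected_via G ds x y)"
      using I(3) assms(6) unfolding weak_components_def by (auto elim!: quotientE)
    obtain b ds where b: "b \<in> W" "path_alg_length ds = 1" "connected_via (induced_digraph G W) ds b b"
      using I(5) by (auto simp: has_alg_length_def closed_alg_length_def induced_digraph_def)
    obtain h where h: "h 0 = b" "h (length ds) = b"
      "\<And>i. i < length ds \<Longrightarrow> if ds ! i then (h i, h (Suc i)) \<in> ?E else (h (Suc i), h i) \<in> ?E"
    proof -
      have "W \<subseteq> pverts G" using W assms(6) by blast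
      from connected_via_induced[OF b(3) this] show thesis by (rule connected_viaE) (rule that)
    qed
    then have bg: "(b, g b) \<in> P.r" using b W by (intro P.level_of_closed_path[of h b ds]) auto
    \<comment> \<open>The class of \<open>b\<close> is closed under edges in both directions, so it
      contains the weak component \<open>W\<close> of \<open>b\<close>, and with it
      \<open>I\<close>.\<close>
    have inv: "u \<in> ?W b \<longleftrightarrow> v \<in> ?W b" if uv: "connected_via G ds u v" for ds u v
    proof -
      obtain h where "h 0 = u" "h (length ds) = v"
        "\<And>i. i < length ds \<Longrightarrow> if ds ! i then (h i, h (Suc i)) \<in> ?E else (h (Suc i), h i) \<in> ?E"
        using uv by (rule connected_viaE) blast
      then show ?thesis
        using path_in_invariant[of ?E "?W b" ds h] P.class_closed[OF bg] by auto
    qed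
    have "b \<in> ?W b" using b W P.r_refl by blast
    then have "x \<in> ?W b" using b(1) W inv by blast
    then have "I \<subseteq> ?W b" using I(4) W inv by blast
    moreover have "absorbing ?F ?A I" using absorbing_term_ops[OF I(1)] I(2) by blast
    ultimately have "absorbing ?F ?A (?W b)" using component[OF bg] I(1) by blast
    moreover obtain J where J: "minimal_absorbing ?F (?W b) J" "\<exists>c\<in>J. (c, c) \<in> ?E"
      using component[OF bg] by blast
    ultimately have "minimal_absorbing ?F ?A J" using minimal_absorbing_trans by blast
    then show ?thesis using J(2) minimal_absorbing_term_ops by blast
  qed
  then show ?thesis using loop by blast
qed

end
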